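(* Let $n\ge 1$ and let $x=(a_1,\dots,a_n)\in R_n$ (one-line notation). Then the dimension $\ell(x)=\dim(BxB)$ of the orbit $BxB$ is given by $$\ell(x)=\Big(\sum_{i=1}^n a_i^*\Big)-\mathrm{coinv}(x),\qquad\text{where}\quad a_i^*=\begin{cases}a_i+n-i, & \text{if } a_i\neq 0,\\ 0,& \text{if } a_i=0.\end{cases}$$
   Context: Let $\mathbb{F}$ be an algebraically closed field, $M_n$ the monoid (affine space) of $n\times n$ matrices over $\mathbb{F}$, $GL_n\subset M_n$ the general linear group, and $B\subset GL_n$ the subgroup of invertible upper triangular matrices. The rook monoid $R_n\subset M_n$ is the set of $n\times n$ $0$-$1$ matrices with at most one nonzero entry in each row and each column. One-line notation: $x=(x_{ij})\in R_n$ is written $x=(a_1,\dots,a_n)$, where $a_j=0$ if the $j$-th column of $x$ is zero, and $a_j=i$ if $x_{ij}=1$. A pair $(i,j)$ with $1\le i<j\le n$ is a coinversion pair of $x$ if $0<a_i<a_j$; $\mathrm{coinv}(x)$ denotes the number of coinversion pairs of $x$. $\dim(BxB)$ is the dimension of the double coset $BxB=\{bxb' : b,b'\in B\}$, an orbit of $B\times B$ in $M_n$, as an algebraic variety (equivalently, the dimension of its Zariski closure in $M_n$). *)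

theory Defs
  imports
    "HOL-Analysis.Abstract_Topology"
    "HOL-Library.Extended_Nat"
    "HOL-Computational_Algebra.Polynomial"
    "Jordan_Normal_Form.Matrix"
begin

section \<open>The Zariski topology on the affine space of square matrices\<close>

inductive_set polynomial_functions :: "nat \<Rightarrow> ('a::comm_ring_1 mat \<Rightarrow> 'a) set"
  for n :: nat where
  const: "(\<lambda>A. c) \<in> polynomial_functions n"
| coord: "i < n \<Longrightarrow> j < n \<Longrightarrow> (\<lambda>A. A $$ (i, j)) \<in> polynomial_functions n"
| add: "f \<in> polynomial_functions n \<Longrightarrow> g \<in> polynomial_functions n \<Longrightarrow>
    (\<lambda>A. f A + g A) \<in> polynomial_functions n"
| mult: "f \<in> polynomial_functions n \<Longrightarrow> g \<in> polynomial_functions n \<Longrightarrow>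
    (\<lambda>A. f A * g A) \<in> polynomial_functions n"

definition zero_locus :: "nat \<Rightarrow> ('a::comm_ring_1 mat \<Rightarrow> 'a) set \<Rightarrow> 'a mat set" where
  "zero_locus n P = {A \<in> carrier_mat n n. \<forall>f\<in>P. f A = 0}"

definition zariski_closed :: "nat \<Rightarrow> 'a::comm_ring_1 mat set \<Rightarrow> bool" where
  "zariski_closed n Z \<longleftrightarrow> (\<exists>P. P \<subseteq> polynomial_functions n \<and> Z = zero_locus n P)"

text \<open>The lemma \<open>closedin_zariski\<close> below shows that the closed sets of this topology are
  exactly the \<^const>\<open>zariski_closed\<close> ones.\<close>

definition zariski :: "nat \<Rightarrow> 'a::idom mat topology" where
  "zariski n = topology (\<lambda>U. U \<subseteq> carrier_mat n n \<and> zariski_closed n (carrier_mat n n - U))"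

lemma zariski_closed_Un:
  fixes Y Z :: "'a::idom mat set"
  assumes "zariski_closed n Y" "zariski_closed n Z"
  shows "zariski_closed n (Y \<union> Z)"
proof -
  obtain P Q where P: "P \<subseteq> polynomial_functions n" "Y = zero_locus n P"
    and Q: "Q \<subseteq> polynomial_functions n" "Z = zero_locus n Q"
    using assms unfolding zariski_closed_def by blast
  define R where "R = {\<lambda>A. f A * g A | f g. f \<in> P \<and> g \<in> Q}"
  have "R \<subseteq> polynomial_functions n"
    using P Q by (auto simp: R_def intro!: polynomial_functions.mult)
  moreover have "Y \<union> Z = zero_locus n R"
  proof (intro equalityI subsetI)
    fix A assume "A \<in> Y \<union> Z"
    then show "A \<in> zero_locus n R"
      unfolding P Q zero_locus_def R_def by auto
  next
    fix A assume A: "A \<in> zero_locus n R"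
    have prod: "f A * g A = 0" if "f \<in> P" "g \<in> Q" for f g
    proof -
      have mem: "(\<lambda>A. f A * g A) \<in> R" using that unfolding R_def by blast
      have "\<forall>h\<in>R. h A = 0" using A by (simp add: zero_locus_def)
      from bspec[OF this mem] show ?thesis .
    qed
    show "A \<in> Y \<union> Z"
    proof (cases "\<forall>f\<in>P. f A = 0")
      case True
      then show ?thesis using A unfolding P zero_locus_def by auto
    next
      case False
      then obtain f where "f \<in> P" "f A \<noteq> 0" by auto
      then have "\<forall>g\<in>Q. g A = 0" using prod by fastforce
      then show ?thesis using A unfolding Q zero_locus_def by auto
    qed
  qed
  ultimately show ?thesis unfolding zariski_closed_def by blast
qed

lemma zariski_closed_carrier: "zariski_closed n (carrier_mat n n)"
  unfolding zariski_closed_def zero_locus_def by (intro exI[of _ "{}"]) auto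

lemma zariski_closed_Inter:
  assumes "\<And>Z. Z \<in> \<Z> \<Longrightarrow> zariski_closed n Z"
  shows "zariski_closed n (carrier_mat n n \<inter> \<Inter>\<Z>)"
proof -
  from assms have "\<forall>Z\<in>\<Z>. \<exists>P. P \<subseteq> polynomial_functions n \<and> Z = zero_locus n P"
    unfolding zariski_closed_def by blast
  then obtain p where "\<forall>Z\<in>\<Z>. p Z \<subseteq> polynomial_functions n \<and> Z = zero_locus n (p Z)"
    by metis
  then have p: "p Z \<subseteq> polynomial_functions n" "Z = zero_locus n (p Z)" if "Z \<in> \<Z>" for Z
    using that by blast+
  have "carrier_mat n n \<inter> \<Inter>\<Z> = carrier_mat n n \<inter> (\<Inter>Z\<in>\<Z>. zero_locus n (p Z))"
    using p(2) by auto
  also have "\<dots> = zero_locus n (\<Union>Z\<in>\<Z>. p Z)"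
    unfolding zero_locus_def by auto
  finally have "carrier_mat n n \<inter> \<Inter>\<Z> = zero_locus n (\<Union>Z\<in>\<Z>. p Z)" .
  moreover have "(\<Union>Z\<in>\<Z>. p Z) \<subseteq> polynomial_functions n"
    using p(1) by (rule UN_least)
  ultimately show ?thesis
    unfolding zariski_closed_def by metis
qed

lemma istopology_zariski:
  "istopology (\<lambda>U. U \<subseteq> carrier_mat n n \<and>
     zariski_closed n (carrier_mat n n - U :: 'a::idom mat set))"
  unfolding istopology_def
proof (intro conjI allI impI)
  fix S T :: "'a mat set"
  assume S: "S \<subseteq> carrier_mat n n \<and> zariski_closed n (carrier_mat n n - S)"
    and T: "T \<subseteq> carrier_mat n n \<and> zariski_closed n (carrier_mat n n - T)"
  show "S \<inter> T \<subseteq> carrier_mat n n" using S by blast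
  show "zariski_closed n (carrier_mat n n - S \<inter> T)"
    unfolding Diff_Int using S T by (intro zariski_closed_Un) simp_all
next
  fix \<K> :: "'a mat set set"
  assume K: "\<forall>K\<in>\<K>. K \<subseteq> carrier_mat n n \<and> zariski_closed n (carrier_mat n n - K)"
  then show "\<Union>\<K> \<subseteq> carrier_mat n n" by blast
  have "zariski_closed n (carrier_mat n n \<inter> \<Inter>((\<lambda>K. carrier_mat n n - K) ` \<K>))"
    using K by (intro zariski_closed_Inter) auto
  also have "carrier_mat n n \<inter> \<Inter>((\<lambda>K. carrier_mat n n - K) ` \<K>) = carrier_mat n n - \<Union>\<K>"
    by auto
  finally show "zariski_closed n (carrier_mat n n - \<Union>\<K>)" .
qed

lemma openin_zariski:
  "openin (zariski n) U \<longleftrightarrow> U \<subseteq> carrier_mat n n \<and> zariski_closed n (carrier_mat n n - U)"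
  unfolding zariski_def topology_inverse'[OF istopology_zariski] ..

lemma topspace_zariski: "topspace (zariski n :: 'a::idom mat topology) = carrier_mat n n"
proof -
  have "(\<lambda>A. 1 :: 'a) \<in> polynomial_functions n" by (rule polynomial_functions.const)
  then have "zariski_closed n ({} :: 'a mat set)"
    unfolding zariski_closed_def zero_locus_def
    by (intro exI[of _ "{\<lambda>A. 1}"]) auto
  then have "openin (zariski n) (carrier_mat n n :: 'a mat set)"
    by (simp add: openin_zariski)
  then have "carrier_mat n n \<subseteq> topspace (zariski n :: 'a mat topology)"
    by (rule openin_subset)
  moreover have "topspace (zariski n :: 'a mat topology) \<subseteq> carrier_mat n n"
    using openin_topspace[of "zariski n :: 'a mat topology"] unfolding openin_zariski by (rule conjunct1)
  ultimately show ?thesis by (rule equalityI[rotated])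
qed

lemma closedin_zariski: "closedin (zariski n) Z \<longleftrightarrow> zariski_closed n Z"
proof -
  have sub: "Z \<subseteq> carrier_mat n n" if "zariski_closed n Z"
    using that unfolding zariski_closed_def zero_locus_def by blast
  have "closedin (zariski n) Z \<longleftrightarrow> Z \<subseteq> carrier_mat n n \<and> zariski_closed n Z"
    by (auto simp: closedin_def topspace_zariski openin_zariski double_diff)
  then show ?thesis using sub by blast
qed


section \<open>Dimension\<close>

definition irreducible_space :: "'b topology \<Rightarrow> bool" where
  "irreducible_space X \<longleftrightarrow> topspace X \<noteq> {} \<and>
     (\<forall>Y Z. closedin X Y \<and> closedin X Z \<and> topspace X = Y \<union> Z \<longrightarrow>
        Y = topspace X \<or> Z = topspace X)"

text \<open>The dimension is the supremum of the lengths \<open>d\<close> of strict chains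
  \<open>Z 0 \<subset> Z 1 \<subset> \<dots> \<subset> Z d\<close> of irreducible closed subsets. The empty
  space gets dimension \<open>0\<close> here, which is immaterial for orbits.\<close>

definition krull_dim :: "'b topology \<Rightarrow> enat" where
  "krull_dim X = Sup {enat d | d. \<exists>Z :: nat \<Rightarrow> 'b set.
     (\<forall>i\<le>d. closedin X (Z i) \<and> irreducible_space (subtopology X (Z i))) \<and>
     (\<forall>i<d. Z i \<subset> Z (Suc i))}"


section \<open>The rook monoid, the Borel subgroup and its double cosets\<close>

definition rook_monoid :: "nat \<Rightarrow> 'a::comm_ring_1 mat set" where
  "rook_monoid n = {x \<in> carrier_mat n n.
     (\<forall>i<n. \<forall>j<n. x $$ (i, j) \<in> {0, 1}) \<and>
     (\<forall>i<n. \<forall>j<n. \<forall>k<n. x $$ (i, j) \<noteq> 0 \<and> x $$ (i, k) \<noteq> 0 \<longrightarrow> j = k) \<and>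
     (\<forall>j<n. \<forall>i<n. \<forall>k<n. x $$ (i, j) \<noteq> 0 \<and> x $$ (k, j) \<noteq> 0 \<longrightarrow> i = k)}"

definition borel_subgroup :: "nat \<Rightarrow> 'a::comm_ring_1 mat set" where
  "borel_subgroup n = {b \<in> carrier_mat n n. invertible_mat b \<and> upper_triangular b}"

definition double_coset :: "nat \<Rightarrow> 'a::comm_ring_1 mat \<Rightarrow> 'a mat set" where
  "double_coset n x = {b * x * b' | b b'. b \<in> borel_subgroup n \<and> b' \<in> borel_subgroup n}"

definition orbit_dim :: "nat \<Rightarrow> 'a::idom mat \<Rightarrow> enat" where
  "orbit_dim n x = krull_dim (subtopology (zariski n) (double_coset n x))"

text \<open>In the one-line notation rows and columns are numbered from \<open>1\<close>, whereas matrix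
  entries are indexed from \<open>0\<close>; a zero column gives the value \<open>0\<close>.\<close>

definition one_line :: "nat \<Rightarrow> 'a::comm_ring_1 mat \<Rightarrow> nat \<Rightarrow> nat" where
  "one_line n x j =
     (if \<exists>i\<in>{1..n}. x $$ (i - 1, j - 1) = 1
      then THE i. i \<in> {1..n} \<and> x $$ (i - 1, j - 1) = 1
      else 0)"

definition coinv :: "nat \<Rightarrow> 'a::comm_ring_1 mat \<Rightarrow> nat" where
  "coinv n x = card {(i, j). 1 \<le> i \<and> i < j \<and> j \<le> n \<and>
     0 < one_line n x i \<and> one_line n x i < one_line n x j}"

definition a_star :: "nat \<Rightarrow> 'a::comm_ring_1 mat \<Rightarrow> nat \<Rightarrow> int" where
  "a_star n x i =
     (if one_line n x i \<noteq> 0 then int (one_line n x i) + int n - int i else 0)"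

end

theory Submission
  imports Defs "HOL-Library.Function_Algebras" "Jordan_Normal_Form.Determinant"
begin

text \<open>Write \<open>a c\<close> for the height (counted from \<open>1\<close>) of the rook in column \<open>c\<close>, and \<open>0\<close> if the column is
empty. The theorem holds because the double coset is swept out by affine coordinates whose number
is the right hand side of the formula. Left multiplication by \<open>B\<close> turns \<open>x\<close> into a matrix \<open>M\<close>
whose entries are arbitrary weakly above the rooks (nonzero at them) and zero elsewhere:
\<open>\<Sum>\<^sub>c a c\<close> coordinates. Right multiplication contributes an upper unitriangular matrix \<open>V\<close>, of which
only the rows of occupied columns \<open>i\<close> matter, and there an entry \<open>(i, c)\<close> with \<open>a i < a c\<close> is
redundant: adding a multiple of column \<open>i\<close> to column \<open>c\<close> stays within the shape of \<open>M\<close>, so it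
can be moved to the other factor. For each occupied column \<open>i\<close> there
remain the entries of row \<open>i\<close> to the right of the diagonal, except one for every coinversion
pair that starts with \<open>i\<close>. So every matrix of the double coset is
\<open>cell_map t = M t * V t\<close> for some assignment \<open>t\<close> of values to a set \<open>cells\<close> of parameters.

The dimension is at most the number of parameters (\<open>krull_dim_le_parameters\<close>). A
chain \<open>Z 0 \<subset> \<dots> \<subset> Z m\<close> of irreducible closed sets provides polynomial functions \<open>f i\<close> that vanish
on \<open>Z i\<close> but not on \<open>Z (Suc i)\<close>. Peeling off one factor \<open>f i\<close> at a time shows that
monomials in \<open>f 0, \<dots>, f (m - 1)\<close> are linearly independent on \<open>Z m\<close>. Pulled back along the
parametrisation, the \<open>K ^ m\<close> monomials with exponents below \<open>K\<close> lie in the space of polynomials in the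
\<open>d\<close> parameters of degree \<open>O(K)\<close>, whose dimension is \<open>O(K ^ d)\<close>. Hence \<open>m \<le> d\<close>.

The dimension is at least the number of parameters (\<open>krull_dim_ge_parameters\<close>). Release
the parameters one after the other from the value that they have at \<open>x\<close>, and
take Zariski closures of the images. These closures are irreducible because the field is infinite, and
with a good order they grow strictly: first the entries of \<open>V\<close>, then the entries of \<open>M\<close> column by
column from right to left. In this order, each parameter is equal to a matrix entry of
\<open>cell_map t\<close> as long as the later parameters have their initial values
(\<open>cell_map_left_coordinate\<close>, \<open>cell_map_right_coordinate\<close>), so that an entry function tells the two
closures apart.\<close>

section \<open>Linear independence of families of functions\<close>

text \<open>Independence is stated for families rather than sets of functions, and relative to the set \<open>Y\<close>
on which the functions are compared: independence on one member of a chain of sets is going to imply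
the independence of a larger family on the next one.\<close>
definition indep_on :: "'b set \<Rightarrow> 'j set \<Rightarrow> ('j \<Rightarrow> 'b \<Rightarrow> 'a::field) \<Rightarrow> bool" where
  "indep_on Y J u \<longleftrightarrow> (\<forall>c. (\<forall>y\<in>Y. (\<Sum>j\<in>J. c j * u j y) = 0) \<longrightarrow> (\<forall>j\<in>J. c j = 0))"

interpretation fun_space: vector_space "\<lambda>(c::'a::field) (f::'b \<Rightarrow> 'a) x. c * f x"
  by unfold_locales (auto simp: fun_eq_iff algebra_simps)

lemma sum_fun_apply: "(\<Sum>j\<in>J. f j) x = (\<Sum>j\<in>J. f j x)"
  by (induction J rule: infinite_finite_induct) auto

lemma card_le_of_indep_on_span:
  fixes u :: "'j \<Rightarrow> 'b \<Rightarrow> 'a::field"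
  assumes indep: "indep_on UNIV J u" and "finite J" and "finite B"
    and span: "\<And>j. j \<in> J \<Longrightarrow> u j \<in> fun_space.span B"
  shows "card J \<le> card B"
proof -
  have inj: "inj_on u J"
  proof (rule inj_onI, rule ccontr)
    fix i j assume ij: "i \<in> J" "j \<in> J" "u i = u j" "i \<noteq> j"
    define c :: "'j \<Rightarrow> 'a" where "c k = (if k = i then 1 else if k = j then -1 else 0)" for k
    have "(\<Sum>k\<in>J. c k * u k y) = 0" for y
    proof -
      have "(\<Sum>k\<in>J. c k * u k y) = (\<Sum>k\<in>{i, j}. c k * u k y)"
        using ij \<open>finite J\<close> by (intro sum.mono_neutral_right) (auto simp: c_def)
      also have "\<dots> = 0" using ij by (simp add: c_def)
      finally show ?thesis .
    qed
    then have "c i = 0" using indep ij unfolding indep_on_def by blast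
    then show False by (simp add: c_def)
  qed
  have "fun_space.independent (u ` J)"
  proof (rule fun_space.independent_if_scalars_zero)
    fix f v assume 0: "(\<Sum>v\<in>u ` J. (\<lambda>x. f v * v x)) = 0" and v: "v \<in> u ` J"
    have "(\<Sum>j\<in>J. f (u j) * u j y) = 0" for y
    proof -
      have "(\<Sum>j\<in>J. f (u j) * u j y) = (\<Sum>v\<in>u ` J. (\<lambda>x. f v * v x)) y"
        by (simp add: sum_fun_apply sum.reindex[OF inj])
      then show ?thesis using 0 by simp
    qed
    then show "f v = 0"
      using indep v unfolding indep_on_def by (auto dest: spec[where x = "\<lambda>j. f (u j)"])
  qed (use \<open>finite J\<close> in simp)
  then have "card (u ` J) \<le> card B"
    using fun_space.independent_span_bound[OF \<open>finite B\<close>] span by blast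
  then show ?thesis by (simp add: card_image inj)
qed

section \<open>Polynomials of bounded degree in finitely many parameters\<close>

definition monomial_fun :: "'i set \<Rightarrow> ('i \<Rightarrow> nat) \<Rightarrow> ('i \<Rightarrow> 'a::field) \<Rightarrow> 'a" where
  "monomial_fun I \<alpha> t = (\<Prod>p\<in>I. t p ^ \<alpha> p)"

definition monomials_upto :: "'i set \<Rightarrow> nat \<Rightarrow> (('i \<Rightarrow> 'a::field) \<Rightarrow> 'a) set" where
  "monomials_upto I D = monomial_fun I ` (I \<rightarrow>\<^sub>E {..D})"

text \<open>The degree bound is imposed on each variable separately. Like the total degree it is additive
under multiplication, and it makes the monomials a product set that is counted at once.\<close>
definition polys_upto :: "'i set \<Rightarrow> nat \<Rightarrow> (('i \<Rightarrow> 'a::field) \<Rightarrow> 'a) set" where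
  "polys_upto I D = fun_space.span (monomials_upto I D)"

lemma finite_monomials_upto: "finite I \<Longrightarrow> finite (monomials_upto I D)"
  by (simp add: monomials_upto_def finite_PiE)

lemma card_monomials_upto:
  assumes "finite I"
  shows "card (monomials_upto I D :: (('i \<Rightarrow> 'a::field) \<Rightarrow> 'a) set) \<le> (D + 1) ^ card I"
proof -
  have "card (monomials_upto I D :: (('i \<Rightarrow> 'a) \<Rightarrow> 'a) set) \<le> card (I \<rightarrow>\<^sub>E {..D})"
    unfolding monomials_upto_def by (rule card_image_le) (simp add: assms finite_PiE)
  also have "\<dots> = (D + 1) ^ card I"
    by (simp add: card_PiE assms)
  finally show ?thesis .
qed

lemma monomial_fun_mem:
  assumes "\<And>p. p \<in> I \<Longrightarrow> \<alpha> p \<le> D"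
  shows "monomial_fun I \<alpha> \<in> monomials_upto I D"
proof -
  have "monomial_fun I \<alpha> = monomial_fun I (restrict \<alpha> I)"
    by (simp add: monomial_fun_def fun_eq_iff)
  moreover have "restrict \<alpha> I \<in> I \<rightarrow>\<^sub>E {..D}" using assms by auto
  ultimately show ?thesis unfolding monomials_upto_def by blast
qed

lemma polys_upto_mono: "D \<le> D' \<Longrightarrow> polys_upto I D \<subseteq> polys_upto I D'"
  unfolding polys_upto_def monomials_upto_def
  by (intro fun_space.span_mono image_mono PiE_mono) auto

lemma polys_upto_add:
  "f \<in> polys_upto I D \<Longrightarrow> g \<in> polys_upto I D \<Longrightarrow> (\<lambda>t. f t + g t) \<in> polys_upto I D"
  using fun_space.span_add[of f _ g] unfolding polys_upto_def plus_fun_def by blast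

lemma polys_upto_sum:
  assumes "\<And>i. i \<in> A \<Longrightarrow> f i \<in> polys_upto I D"
  shows "(\<lambda>t. \<Sum>i\<in>A. f i t) \<in> polys_upto I D"
proof -
  have "(\<Sum>i\<in>A. f i) \<in> polys_upto I D"
    using assms unfolding polys_upto_def by (rule fun_space.span_sum)
  also have "(\<Sum>i\<in>A. f i) = (\<lambda>t. \<Sum>i\<in>A. f i t)"
    by (simp add: fun_eq_iff sum_fun_apply)
  finally show ?thesis .
qed

lemma polys_upto_const: "(\<lambda>t. c) \<in> polys_upto I D"
proof -
  have "monomial_fun I (\<lambda>_. 0) \<in> polys_upto I D"
    unfolding polys_upto_def by (intro fun_space.span_base monomial_fun_mem) simp
  then have "(\<lambda>t. c * monomial_fun I (\<lambda>_. 0) t) \<in> polys_upto I D"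
    unfolding polys_upto_def by (rule fun_space.span_scale)
  then show ?thesis by (simp add: monomial_fun_def)
qed

lemma polys_upto_coord:
  assumes "finite I" "p \<in> I"
  shows "(\<lambda>t. t p) \<in> polys_upto I 1"
proof -
  have "monomial_fun I (\<lambda>q. if q = p then 1 else 0) \<in> polys_upto I 1"
    unfolding polys_upto_def by (intro fun_space.span_base monomial_fun_mem) simp
  also have "monomial_fun I (\<lambda>q. if q = p then 1 else 0) = (\<lambda>t. t p)"
    using assms by (simp add: monomial_fun_def fun_eq_iff if_distrib[of "power _"] prod.delta
        cong: if_cong)
  finally show ?thesis .
qed

lemma polys_upto_mult:
  fixes f g :: "('i \<Rightarrow> 'a::field) \<Rightarrow> 'a"
  assumes "f \<in> polys_upto I D" "g \<in> polys_upto I E"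
  shows "(\<lambda>t. f t * g t) \<in> polys_upto I (D + E)"
proof -
  have sub: "fun_space.subspace {f. (\<lambda>t. f t * h t) \<in> polys_upto I (D + E)}"
    for h :: "('i \<Rightarrow> 'a) \<Rightarrow> 'a"
  proof (rule fun_space.subspaceI; clarsimp simp: ring_distribs mult.assoc)
    show "(\<lambda>t. 0) \<in> polys_upto I (D + E)" by (rule polys_upto_const)
  next
    fix f g :: "('i \<Rightarrow> 'a) \<Rightarrow> 'a"
    assume "(\<lambda>t. f t * h t) \<in> polys_upto I (D + E)" "(\<lambda>t. g t * h t) \<in> polys_upto I (D + E)"
    then show "(\<lambda>t. f t * h t + g t * h t) \<in> polys_upto I (D + E)" by (rule polys_upto_add)
  next
    fix c and f :: "('i \<Rightarrow> 'a) \<Rightarrow> 'a"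
    assume "(\<lambda>t. f t * h t) \<in> polys_upto I (D + E)"
    then show "(\<lambda>t. c * (f t * h t)) \<in> polys_upto I (D + E)"
      unfolding polys_upto_def by (rule fun_space.span_scale)
  qed
  have mono: "(\<lambda>t. m t * m' t) \<in> polys_upto I (D + E)"
    if m: "m \<in> monomials_upto I D" "m' \<in> monomials_upto I E" for m m' :: "('i \<Rightarrow> 'a) \<Rightarrow> 'a"
  proof -
    obtain \<alpha> \<beta> where \<alpha>: "m = monomial_fun I \<alpha>" "\<alpha> \<in> I \<rightarrow>\<^sub>E {..D}"
      and \<beta>: "m' = monomial_fun I \<beta>" "\<beta> \<in> I \<rightarrow>\<^sub>E {..E}"
      using m unfolding monomials_upto_def by blast
    have "monomial_fun I (\<lambda>p. \<alpha> p + \<beta> p) \<in> polys_upto I (D + E)"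
      unfolding polys_upto_def using \<alpha> \<beta>
      by (intro fun_space.span_base monomial_fun_mem) (auto intro!: add_mono)
    also have "monomial_fun I (\<lambda>p. \<alpha> p + \<beta> p) = (\<lambda>t. m t * m' t)"
      unfolding \<alpha>(1) \<beta>(1) by (simp add: monomial_fun_def fun_eq_iff power_add prod.distrib)
    finally show ?thesis .
  qed
  have "(\<lambda>t. f t * m' t) \<in> polys_upto I (D + E)" if "m' \<in> monomials_upto I E" for m'
    using assms(1) unfolding polys_upto_def[of I D]
    by (rule fun_space.span_induct[OF _ sub]) (use mono that in blast)
  then have *: "(\<lambda>t. m' t * f t) \<in> polys_upto I (D + E)" if "m' \<in> monomials_upto I E" for m'
    using that by (simp add: mult.commute[of "m' _"])
  have "(\<lambda>t. g t * f t) \<in> polys_upto I (D + E)"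
    using assms(2) unfolding polys_upto_def[of I E]
    by (rule fun_space.span_induct[OF _ sub]) (use * in blast)
  then show ?thesis by (simp add: mult.commute[of "g _"])
qed

lemma polys_upto_power:
  assumes "f \<in> polys_upto I D"
  shows "(\<lambda>t. f t ^ k) \<in> polys_upto I (k * D)"
  by (induction k) (auto simp: polys_upto_const intro: polys_upto_mult[OF assms])

text \<open>The degree \<open>E\<close> depends on \<open>f\<close>; for the growth argument it only has to exist.\<close>
lemma polynomial_function_pullback:
  fixes \<phi> :: "('i \<Rightarrow> 'a::field) \<Rightarrow> 'a mat"
  assumes "f \<in> polynomial_functions n"
    and entries: "\<And>i j. i < n \<Longrightarrow> j < n \<Longrightarrow> (\<lambda>t. \<phi> t $$ (i, j)) \<in> polys_upto I D"
  shows "\<exists>E. (\<lambda>t. f (\<phi> t)) \<in> polys_upto I E"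
  using assms(1)
proof induction
  case (const c)
  show ?case using polys_upto_const by blast
next
  case (coord i j)
  then show ?case using entries by blast
next
  case (add f g)
  then obtain E F where *: "(\<lambda>t. f (\<phi> t)) \<in> polys_upto I E" "(\<lambda>t. g (\<phi> t)) \<in> polys_upto I F"
    by blast
  have "(\<lambda>t. f (\<phi> t)) \<in> polys_upto I (max E F)" "(\<lambda>t. g (\<phi> t)) \<in> polys_upto I (max E F)"
    using * polys_upto_mono[of E "max E F" I] polys_upto_mono[of F "max E F" I] by auto
  then show ?case using polys_upto_add by blast
next
  case (mult f g)
  then show ?case using polys_upto_mult by blast
qed

section \<open>Chains of irreducible sets give algebraically independent functions\<close>

text \<open>The value at \<open>y\<close> of the monomial in \<open>f 0, f 1, \<dots>\<close> with the given exponents. The head of the list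
is the exponent of the function with the largest index, so that a step up in the chain is a
\<open>Cons\<close>.\<close>
fun mono_eval :: "(nat \<Rightarrow> 'b \<Rightarrow> 'a::field) \<Rightarrow> nat list \<Rightarrow> 'b \<Rightarrow> 'a" where
  "mono_eval f [] y = 1"
| "mono_eval f (k # ks) y = f (length ks) y ^ k * mono_eval f ks y"

definition exponents :: "nat \<Rightarrow> nat \<Rightarrow> nat list set" where
  "exponents K j = {ks. set ks \<subseteq> {..<K} \<and> length ks = j}"

lemma finite_exponents: "finite (exponents K j)"
  unfolding exponents_def by (rule finite_lists_length_eq) simp

lemma card_exponents: "card (exponents K j) = K ^ j"
  unfolding exponents_def by (subst card_lists_length_eq) auto

lemma sum_exponents_Suc:
  "(\<Sum>ks\<in>exponents K (Suc j). h ks) = (\<Sum>k<K. \<Sum>ks\<in>exponents K j. h (k # ks))"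
proof -
  have "exponents K (Suc j) = (\<lambda>(k, ks). k # ks) ` ({..<K} \<times> exponents K j)"
    by (auto simp: exponents_def length_Suc_conv image_iff)
  moreover have "inj_on (\<lambda>(k, ks). k # ks) ({..<K} \<times> exponents K j)"
    by (auto simp: inj_on_def)
  ultimately show ?thesis
    by (simp add: sum.reindex sum.cartesian_product case_prod_unfold)
qed

text \<open>If \<open>f\<close> vanishes on \<open>Z\<close>, restricting a relation \<open>\<Sum>\<^sub>k f\<^sup>k g\<^sub>k = 0\<close> to \<open>Z\<close> leaves \<open>g\<^sub>0 = 0\<close>, so by
independence on \<open>Z\<close> all coefficients of \<open>g\<^sub>0\<close> vanish. The rest of the relation is divisible
by \<open>f\<close>, which can be cancelled on \<open>Y\<close>, and the argument repeats. The hypothesis \<open>cancel\<close> is what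
irreducibility of \<open>Y\<close> provides when \<open>f\<close> is not zero on all of \<open>Y\<close>.\<close>
lemma powers_independent_over:
  assumes "Z \<subseteq> Y" and f0: "\<And>y. y \<in> Z \<Longrightarrow> f y = 0"
    and cancel: "\<And>d K. \<forall>y\<in>Y. f y * (\<Sum>k<K. f y ^ k * (\<Sum>j\<in>J. d k j * u j y)) = 0 \<Longrightarrow>
          \<forall>y\<in>Y. (\<Sum>k<K. f y ^ k * (\<Sum>j\<in>J. d k j * u j y)) = 0"
    and indep: "indep_on Z J u"
    and 0: "\<forall>y\<in>Y. (\<Sum>k<K. f y ^ k * (\<Sum>j\<in>J. d k j * u j y)) = 0"
  shows "\<forall>k<K. \<forall>j\<in>J. d k j = (0::'a::field)"
  using 0
proof (induction K arbitrary: d)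
  case (Suc K)
  have split: "(\<Sum>k<Suc K. f y ^ k * (\<Sum>j\<in>J. d k j * u j y)) =
    (\<Sum>j\<in>J. d 0 j * u j y) + f y * (\<Sum>k<K. f y ^ k * (\<Sum>j\<in>J. d (Suc k) j * u j y))" for y
    by (simp add: sum.lessThan_Suc_shift sum_distrib_left mult.assoc del: sum.lessThan_Suc)
  have "(\<Sum>j\<in>J. d 0 j * u j y) = 0" if "y \<in> Z" for y
    using Suc.prems[rule_format, of y] that \<open>Z \<subseteq> Y\<close> f0[OF that] unfolding split by auto
  then have d0: "\<forall>j\<in>J. d 0 j = 0"
    using indep unfolding indep_on_def by (auto dest: spec[where x = "d 0"])
  have "\<forall>y\<in>Y. f y * (\<Sum>k<K. f y ^ k * (\<Sum>j\<in>J. d (Suc k) j * u j y)) = 0"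
    using Suc.prems d0 unfolding split by simp
  from Suc.IH[OF cancel[OF this]] have "\<forall>k<K. \<forall>j\<in>J. d (Suc k) j = 0" .
  with d0 show ?case by (auto simp: less_Suc_eq_0_disj)
qed simp

lemma polynomial_functions_power:
  "f \<in> polynomial_functions n \<Longrightarrow> (\<lambda>A. f A ^ k) \<in> polynomial_functions n"
  by (induction k) (auto intro: polynomial_functions.intros)

lemma polynomial_functions_sum:
  "(\<And>i. i \<in> J \<Longrightarrow> f i \<in> polynomial_functions n) \<Longrightarrow>
    (\<lambda>A. \<Sum>i\<in>J. f i A) \<in> polynomial_functions n"
  by (induction J rule: infinite_finite_induct) (auto intro: polynomial_functions.intros)

lemma mono_eval_polynomial:
  assumes "\<And>i. i < length ks \<Longrightarrow> f i \<in> polynomial_functions n"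
  shows "mono_eval f ks \<in> polynomial_functions n"
  using assms
proof (induction ks)
  case Nil
  then show ?case using polynomial_functions.const[of 1 n] by (simp add: fun_eq_iff[abs_def])
next
  case (Cons k ks)
  then have "(\<lambda>A. f (length ks) A ^ k * mono_eval f ks A) \<in> polynomial_functions n"
    by (intro polynomial_functions.mult polynomial_functions_power) auto
  then show ?case by (simp add: fun_eq_iff[abs_def])
qed

text \<open>In algebraic terms: the functions \<open>f 0, \<dots>, f (j - 1)\<close> are algebraically independent on \<open>Z j\<close>.\<close>
lemma chain_monomials_indep:
  fixes f :: "nat \<Rightarrow> 'a::field mat \<Rightarrow> 'a" and Z :: "nat \<Rightarrow> 'a mat set"
  assumes "Z 0 \<noteq> {}"
    and mono: "\<And>i. i < j \<Longrightarrow> Z i \<subseteq> Z (Suc i)"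
    and poly: "\<And>i. i < j \<Longrightarrow> f i \<in> polynomial_functions n"
    and vanish: "\<And>i A. i < j \<Longrightarrow> A \<in> Z i \<Longrightarrow> f i A = 0"
    and cancel: "\<And>i g. i < j \<Longrightarrow> g \<in> polynomial_functions n \<Longrightarrow>
          \<forall>A\<in>Z (Suc i). f i A * g A = 0 \<Longrightarrow> \<forall>A\<in>Z (Suc i). g A = 0"
  shows "indep_on (Z j) (exponents K j) (mono_eval f)"
  using assms(2-)
proof (induction j)
  case 0
  have "exponents K 0 = {[]}" by (auto simp: exponents_def)
  then show ?case using \<open>Z 0 \<noteq> {}\<close> by (auto simp: indep_on_def)
next
  case (Suc j)
  have IH: "indep_on (Z j) (exponents K j) (mono_eval f)"
    by (rule Suc.IH)
      (simp_all only: Suc.prems(1-3) less_SucI, rule Suc.prems(4), simp_all only: less_SucI)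
  show ?case
    unfolding indep_on_def
  proof (intro allI impI)
    fix c assume c: "\<forall>A\<in>Z (Suc j). (\<Sum>ks\<in>exponents K (Suc j). c ks * mono_eval f ks A) = 0"
    have len: "length ks = j" if "ks \<in> exponents K j" for ks
      using that by (simp add: exponents_def)
    have "(\<Sum>ks\<in>exponents K (Suc j). c ks * mono_eval f ks A) =
      (\<Sum>k<K. f j A ^ k * (\<Sum>ks\<in>exponents K j. c (k # ks) * mono_eval f ks A))" for A
      unfolding sum_exponents_Suc sum_distrib_left
      by (intro sum.cong) (auto simp: len mult_ac)
    with c have eq: "\<forall>A\<in>Z (Suc j).
      (\<Sum>k<K. f j A ^ k * (\<Sum>ks\<in>exponents K j. c (k # ks) * mono_eval f ks A)) = 0"
      by simp
    have poly: "(\<lambda>A. \<Sum>k<L. f j A ^ k * (\<Sum>ks\<in>exponents K j. d k ks * mono_eval f ks A))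
        \<in> polynomial_functions n" for L d
      by (intro polynomial_functions_sum polynomial_functions.mult polynomial_functions_power
          polynomial_functions.const mono_eval_polynomial Suc.prems) (auto simp: len)
    have "\<forall>k<K. \<forall>ks\<in>exponents K j. c (k # ks) = 0"
      by (rule powers_independent_over[where Y = "Z (Suc j)" and f = "f j" and Z = "Z j"
            and u = "mono_eval f", OF _ _ _ IH eq])
        (simp_all only: Suc.prems(1,3) lessI, rule Suc.prems(4)[OF lessI poly], simp only:)
    then show "\<forall>ks\<in>exponents K (Suc j). c ks = 0"
      by (auto simp: exponents_def length_Suc_conv)
  qed
qed

text \<open>The count behind the upper bound: if \<open>m > card I\<close>, then \<open>K ^ m\<close> independent functions would
lie in a space of dimension at most \<open>(K * S + 1) ^ card I\<close>, where \<open>S\<close> is the sum of degree bounds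
for the pullbacks of the \<open>f i\<close>, which is impossible for large \<open>K\<close>.\<close>
lemma chain_length_le:
  fixes f :: "nat \<Rightarrow> 'a::field mat \<Rightarrow> 'a" and Z :: "nat \<Rightarrow> 'a mat set"
    and \<phi> :: "('i \<Rightarrow> 'a) \<Rightarrow> 'a mat"
  assumes "finite I"
    and entries: "\<And>i j. i < n \<Longrightarrow> j < n \<Longrightarrow> (\<lambda>t. \<phi> t $$ (i, j)) \<in> polys_upto I D"
    and range: "Z m \<subseteq> range \<phi>"
    and "Z 0 \<noteq> {}"
    and mono: "\<And>i. i < m \<Longrightarrow> Z i \<subseteq> Z (Suc i)"
    and poly: "\<And>i. i < m \<Longrightarrow> f i \<in> polynomial_functions n"
    and vanish: "\<And>i A. i < m \<Longrightarrow> A \<in> Z i \<Longrightarrow> f i A = 0"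
    and cancel: "\<And>i g. i < m \<Longrightarrow> g \<in> polynomial_functions n \<Longrightarrow>
          \<forall>A\<in>Z (Suc i). f i A * g A = 0 \<Longrightarrow> \<forall>A\<in>Z (Suc i). g A = 0"
  shows "m \<le> card I"
proof (rule ccontr)
  assume "\<not> m \<le> card I"
  then have m: "Suc (card I) \<le> m" by simp
  have "\<forall>i\<in>{..<m}. \<exists>E. (\<lambda>t. f i (\<phi> t)) \<in> polys_upto I E"
    using poly polynomial_function_pullback[OF _ entries] by blast
  then obtain e where e: "\<And>i. i < m \<Longrightarrow> (\<lambda>t. f i (\<phi> t)) \<in> polys_upto I (e i)"
    by (metis lessThan_iff)
  define S where "S = (\<Sum>i<m. e i)"
  \<comment> \<open>The count below needs exactly \<open>(S + 1) ^ card I < K\<close>.\<close>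
  define K where "K = (S + 1) ^ card I + 1"
  have deg: "(\<lambda>t. mono_eval f ks (\<phi> t)) \<in> polys_upto I (K * (\<Sum>i<length ks. e i))"
    if "length ks \<le> m" "set ks \<subseteq> {..<K}" for ks
    using that
  proof (induction ks)
    case Nil
    then show ?case by (simp add: polys_upto_const)
  next
    case (Cons k ks)
    have "(\<lambda>t. mono_eval f (k # ks) (\<phi> t))
      \<in> polys_upto I (k * e (length ks) + K * (\<Sum>i<length ks. e i))"
      unfolding mono_eval.simps using Cons by (intro polys_upto_mult polys_upto_power e) auto
    moreover have "k * e (length ks) + K * (\<Sum>i<length ks. e i) \<le> K * (\<Sum>i<length (k # ks). e i)"
      using Cons.prems by (simp add: algebra_simps)
    ultimately show ?case by (rule subsetD[OF polys_upto_mono, rotated])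
  qed
  have "indep_on (Z m) (exponents K m) (mono_eval f)"
    by (rule chain_monomials_indep[OF \<open>Z 0 \<noteq> {}\<close> mono poly vanish cancel])
  then have "indep_on UNIV (exponents K m) (\<lambda>ks t. mono_eval f ks (\<phi> t))"
    using range unfolding indep_on_def by (blast dest: subsetD)
  then have "card (exponents K m) \<le> card (monomials_upto I (K * S) :: (('i \<Rightarrow> 'a) \<Rightarrow> 'a) set)"
  proof (rule card_le_of_indep_on_span[OF _ finite_exponents finite_monomials_upto[OF \<open>finite I\<close>]])
    fix ks assume "ks \<in> exponents K m"
    then show "(\<lambda>t. mono_eval f ks (\<phi> t)) \<in> fun_space.span (monomials_upto I (K * S))"
      using deg[of ks] unfolding polys_upto_def exponents_def S_def by auto
  qed
  also have "\<dots> \<le> (K * S + 1) ^ card I" by (rule card_monomials_upto[OF \<open>finite I\<close>])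
  also have "\<dots> \<le> (K * (S + 1)) ^ card I" by (intro power_mono) (auto simp: K_def)
  also have "\<dots> = K ^ card I * (S + 1) ^ card I" by (rule power_mult_distrib)
  also have "\<dots> < K ^ card I * K" by (intro mult_strict_left_mono) (auto simp: K_def)
  also have "\<dots> = K ^ Suc (card I)" by simp
  also have "\<dots> \<le> K ^ m" using m by (intro power_increasing) (auto simp: K_def)
  finally show False by (simp add: card_exponents)
qed

section \<open>Krull dimension of parametrised subsets of matrix space\<close>

text \<open>Over a finite field, \<open>\<Prod>\<^sub>a (X - a) + 1\<close> would be a polynomial without roots.\<close>
lemma infinite_UNIV_alg_closed: "infinite (UNIV :: 'a::alg_closed_field set)"
proof
  assume fin: "finite (UNIV :: 'a set)"
  define P :: "'a poly" where "P = (\<Prod>a\<in>UNIV. [:-a, 1:])"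
  have "degree P = card (UNIV :: 'a set)"
    unfolding P_def by (subst degree_prod_eq_sum_degree) auto
  then have "degree (P + 1) > 0"
    using fin by (simp add: degree_add_eq_left finite_UNIV_card_ge_0)
  then obtain a where "poly (P + 1) a = 0"
    using alg_closed_imp_poly_has_root by blast
  moreover have "poly P a = 0"
    unfolding P_def using fin by (simp add: poly_prod prod_zero_iff)
  ultimately show False by simp
qed

lemma closed_separating_polynomial:
  assumes "closedin (subtopology (zariski n) X) Y" "A \<in> X" "A \<in> carrier_mat n n" "A \<notin> Y"
  obtains f where "f \<in> polynomial_functions n" "\<And>B. B \<in> Y \<Longrightarrow> f B = 0" "f A \<noteq> 0"
proof -
  obtain P where P: "P \<subseteq> polynomial_functions n" "Y = zero_locus n P \<inter> X"
    using assms(1) unfolding closedin_subtopology closedin_zariski zariski_closed_def by blast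
  then obtain f where "f \<in> P" "f A \<noteq> 0"
    using assms(2-4) by (auto simp: zero_locus_def)
  with that[of f] P show ?thesis by (auto simp: zero_locus_def)
qed

lemma closedin_common_zeros:
  assumes "X \<subseteq> carrier_mat n n" "F \<subseteq> polynomial_functions n"
  shows "closedin (subtopology (zariski n) X) {A \<in> X. \<forall>f\<in>F. f A = 0}"
proof -
  have "{A \<in> X. \<forall>f\<in>F. f A = 0} = zero_locus n F \<inter> X"
    using assms(1) by (auto simp: zero_locus_def)
  then show ?thesis
    using assms(2) unfolding closedin_subtopology closedin_zariski zariski_closed_def by blast
qed

lemma irreducible_cancel:
  fixes Z :: "'a::idom mat set"
  assumes irr: "irreducible_space (subtopology (zariski n) Z)" and Z: "Z \<subseteq> carrier_mat n n"
    and fg: "f \<in> polynomial_functions n" "g \<in> polynomial_functions n"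
    and 0: "\<forall>A\<in>Z. f A * g A = 0" and f: "A0 \<in> Z" "f A0 \<noteq> 0"
  shows "\<forall>A\<in>Z. g A = 0"
proof -
  have top: "topspace (subtopology (zariski n) Z) = Z"
    using Z by (auto simp: topspace_zariski)
  have closed: "closedin (subtopology (zariski n) Z) {A \<in> Z. h A = 0}"
    if "h \<in> polynomial_functions n" for h
    using closedin_common_zeros[OF Z, of "{h}"] that by simp
  have "Z = {A \<in> Z. f A = 0} \<union> {A \<in> Z. g A = 0}" using 0 by auto
  then have "{A \<in> Z. f A = 0} = Z \<or> {A \<in> Z. g A = 0} = Z"
    using irr closed[OF fg(1)] closed[OF fg(2)] unfolding irreducible_space_def top by blast
  then show ?thesis using f by blast
qed

lemma krull_dim_le_parameters:
  fixes \<phi> :: "('i \<Rightarrow> 'a::field) \<Rightarrow> 'a mat"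
  assumes "finite I"
    and entries: "\<And>i j. i < n \<Longrightarrow> j < n \<Longrightarrow> (\<lambda>t. \<phi> t $$ (i, j)) \<in> polys_upto I D"
    and X: "X \<subseteq> carrier_mat n n" "X \<subseteq> range \<phi>"
  shows "krull_dim (subtopology (zariski n) X) \<le> enat (card I)"
  unfolding krull_dim_def
proof (rule Sup_least, clarify)
  let ?T = "subtopology (zariski n) X"
  fix m :: nat and Z :: "nat \<Rightarrow> 'a mat set"
  assume Z: "\<forall>i\<le>m. closedin ?T (Z i) \<and> irreducible_space (subtopology ?T (Z i))"
    and strict: "\<forall>i<m. Z i \<subset> Z (Suc i)"
  have sub: "Z i \<subseteq> X" if "i \<le> m" for i
    using Z that closedin_subset by fastforce
  have irr: "irreducible_space (subtopology (zariski n) (Z i))" if "i \<le> m" for i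
    using Z that sub[OF that] by (auto simp: subtopology_subtopology inf.absorb2)
  have "\<forall>i\<in>{..<m}. \<exists>f A. f \<in> polynomial_functions n \<and> (\<forall>B\<in>Z i. f B = 0) \<and>
      A \<in> Z (Suc i) \<and> f A \<noteq> 0"
  proof
    fix i assume "i \<in> {..<m}"
    then have i: "i < m" by simp
    then obtain A where A: "A \<in> Z (Suc i)" "A \<notin> Z i" using strict by blast
    then have "A \<in> X" using sub[of "Suc i"] i by auto
    moreover have "closedin ?T (Z i)" using Z i by simp
    ultimately show "\<exists>f A. f \<in> polynomial_functions n \<and> (\<forall>B\<in>Z i. f B = 0) \<and>
      A \<in> Z (Suc i) \<and> f A \<noteq> 0"
      using A X closed_separating_polynomial[of n X "Z i" A] by (metis subsetD)
  qed
  from bchoice[OF this] obtain f where f: "\<And>i. i < m \<Longrightarrow> f i \<in> polynomial_functions n"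
      "\<And>i A. i < m \<Longrightarrow> A \<in> Z i \<Longrightarrow> f i A = 0"
      "\<And>i. i < m \<Longrightarrow> \<exists>A \<in> Z (Suc i). f i A \<noteq> 0"
    by (auto simp: Ball_def) metis
  have "m \<le> card I"
  proof (rule chain_length_le[where f = f and Z = Z, OF \<open>finite I\<close> entries])
    show "Z m \<subseteq> range \<phi>" using sub X by blast
    show "Z 0 \<noteq> {}"
      using irr[of 0] sub[of 0] X by (auto simp: irreducible_space_def topspace_zariski)
    show "Z i \<subseteq> Z (Suc i)" if "i < m" for i using strict that by blast
    fix i g assume i: "i < m" and g: "g \<in> polynomial_functions n"
      and 0: "\<forall>A\<in>Z (Suc i). f i A * g A = 0"
    have "Z (Suc i) \<subseteq> carrier_mat n n" using sub[of "Suc i"] i X by auto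
    with irr[of "Suc i"] i g 0 f(1,3)[of i] show "\<forall>A\<in>Z (Suc i). g A = 0"
      using irreducible_cancel[of n "Z (Suc i)" "f i" g] by (meson Suc_leI)
  qed (use f in auto)
  then show "enat m \<le> enat (card I)" by simp
qed

text \<open>The parameters in \<open>F\<close> range freely over their value sets \<open>C p\<close>, all others are frozen at the base point
\<open>t0\<close>.\<close>
definition param_box :: "('i \<Rightarrow> 'a set) \<Rightarrow> ('i \<Rightarrow> 'a) \<Rightarrow> 'i set \<Rightarrow> ('i \<Rightarrow> 'a) set" where
  "param_box C t0 F = {t. \<forall>p. if p \<in> F then t p \<in> C p else t p = t0 p}"

lemma param_box_fixed: "t \<in> param_box C t0 F \<Longrightarrow> p \<notin> F \<Longrightarrow> t p = t0 p"
  by (auto simp: param_box_def split: if_splits)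

lemma param_box_value: "t \<in> param_box C t0 F \<Longrightarrow> p \<in> F \<Longrightarrow> t p \<in> C p"
  by (auto simp: param_box_def split: if_splits)

text \<open>This is the irreducibility of a box with infinite sides. Start from a point where \<open>f\<close> is nonzero
and one where \<open>g\<close> is, and make them agree in one coordinate after the other: on the coordinate
lines through them, \<open>f\<close> and \<open>g\<close> are nonzero polynomials in one variable with finitely many zeros,
so that infinitely many values of the coordinate suit both.\<close>
lemma param_box_common_nonzero:
  fixes f g :: "('i \<Rightarrow> 'a::idom) \<Rightarrow> 'a"
  assumes "finite F" and inf: "\<And>p. p \<in> F \<Longrightarrow> infinite (C p)"
    and f: "\<And>t p. \<exists>q. \<forall>s. f (t(p := s)) = poly q s"
    and g: "\<And>t p. \<exists>q. \<forall>s. g (t(p := s)) = poly q s"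
    and s: "s \<in> param_box C t0 F" "f s \<noteq> 0" and t: "t \<in> param_box C t0 F" "g t \<noteq> 0"
  shows "\<exists>r\<in>param_box C t0 F. f r \<noteq> 0 \<and> g r \<noteq> 0"
proof -
  have "\<exists>s\<in>param_box C t0 F. \<exists>t\<in>param_box C t0 F. f s \<noteq> 0 \<and> g t \<noteq> 0 \<and> (\<forall>p\<in>G. s p = t p)"
    if "G \<subseteq> F" for G
    using finite_subset[OF that \<open>finite F\<close>] that
  proof (induction G)
    case empty
    then show ?case using s t by auto
  next
    case (insert p G)
    then obtain s t where st: "s \<in> param_box C t0 F" "t \<in> param_box C t0 F" "f s \<noteq> 0" "g t \<noteq> 0"
      "\<forall>p\<in>G. s p = t p" by auto
    obtain q1 q2 where q: "\<forall>c. f (s(p := c)) = poly q1 c" "\<forall>c. g (t(p := c)) = poly q2 c"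
      using f g by meson
    have "poly q1 (s p) \<noteq> 0" "poly q2 (t p) \<noteq> 0"
      using st q(1)[rule_format, of "s p"] q(2)[rule_format, of "t p"] by simp_all
    then have "q1 * q2 \<noteq> 0" by auto
    then have "finite {c. poly (q1 * q2) c = 0}" by (rule poly_roots_finite)
    then obtain c where c: "c \<in> C p" "poly (q1 * q2) c \<noteq> 0"
      using inf[of p] insert.prems by (metis (mono_tags, lifting) finite_subset insert_subset
          mem_Collect_eq subsetI)
    have "s(p := c) \<in> param_box C t0 F" "t(p := c) \<in> param_box C t0 F"
      using st c insert.prems by (auto simp: param_box_def)
    moreover have "f (s(p := c)) \<noteq> 0" "g (t(p := c)) \<noteq> 0" using q c by auto
    moreover have "\<forall>p'\<in>insert p G. (s(p := c)) p' = (t(p := c)) p'" using st by simp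
    ultimately show ?case by blast
  qed
  from this[of F] obtain s t where st: "s \<in> param_box C t0 F" "t \<in> param_box C t0 F"
    "f s \<noteq> 0" "g t \<noteq> 0" "\<forall>p\<in>F. s p = t p" by auto
  have "s p = t p" for p
    using st by (cases "p \<in> F") (auto simp: param_box_def)
  then have "s = t" ..
  with st show ?thesis by blast
qed

text \<open>The chain consists of the closures of the images of boxes, the parameters being released in the order
of increasing level \<open>\<kappa>\<close>. The hypothesis \<open>sep\<close> makes every inclusion strict: some polynomial function
vanishes on the image as long as \<open>p\<close> is frozen, even if all other parameters up to the level of \<open>p\<close>
are free, and becomes nonzero when \<open>p\<close> moves. Parameters of equal level may be released
in any order.\<close>
lemma krull_dim_ge_parameters:
  fixes \<phi> :: "('i \<Rightarrow> 'a::field) \<Rightarrow> 'a mat" and \<kappa> :: "'i \<Rightarrow> nat"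
  assumes "finite I"
    and X: "X \<subseteq> carrier_mat n n"
    and inf: "\<And>p. p \<in> I \<Longrightarrow> infinite (C p)" and t0: "\<And>p. p \<in> I \<Longrightarrow> t0 p \<in> C p"
    and into: "\<And>t. t \<in> param_box C t0 I \<Longrightarrow> \<phi> t \<in> X"
    and univ: "\<And>f t p. f \<in> polynomial_functions n \<Longrightarrow> \<exists>q. \<forall>s. f (\<phi> (t(p := s))) = poly q s"
    and sep: "\<And>p. p \<in> I \<Longrightarrow> \<exists>f\<in>polynomial_functions n.
        (\<forall>t\<in>param_box C t0 {q\<in>I. q \<noteq> p \<and> \<kappa> q \<le> \<kappa> p}. f (\<phi> t) = 0) \<and>
        (\<exists>s\<in>C p. f (\<phi> (t0(p := s))) \<noteq> 0)"
  shows "enat (card I) \<le> krull_dim (subtopology (zariski n) X)"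
proof -
  let ?T = "subtopology (zariski n) X"
  have box_mono: "param_box C t0 F \<subseteq> param_box C t0 G" if "F \<subseteq> G" "G \<subseteq> I" for F G
  proof
    fix t assume t: "t \<in> param_box C t0 F"
    have "t p \<in> C p" if "p \<in> G" for p
      using t t0[of p] that \<open>G \<subseteq> I\<close> by (cases "p \<in> F") (auto simp: param_box_def split: if_splits)
    moreover have "t p = t0 p" if "p \<notin> G" for p
      using t that \<open>F \<subseteq> G\<close> by (auto simp: param_box_def split: if_splits)
    ultimately show "t \<in> param_box C t0 G" by (simp add: param_box_def)
  qed
  \<comment> \<open>The Zariski closure in \<open>X\<close> of the image of the box.\<close>
  define Z where "Z F = {A \<in> X. \<forall>f\<in>{f\<in>polynomial_functions n.
      \<forall>t\<in>param_box C t0 F. f (\<phi> t) = 0}. f A = 0}" for F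
  have closed: "closedin ?T (Z F)" for F
    unfolding Z_def by (rule closedin_common_zeros[OF X]) blast
  have sub: "Z F \<subseteq> X" for F by (auto simp: Z_def)
  have phi_Z: "\<phi> t \<in> Z F" if "t \<in> param_box C t0 F" "F \<subseteq> I" for t F
    using into box_mono[OF that(2) order.refl] that by (auto simp: Z_def)
  have irr: "irreducible_space (subtopology ?T (Z F))" if F: "F \<subseteq> I" for F
  proof -
    have eq: "subtopology ?T (Z F) = subtopology (zariski n) (Z F)"
      using sub[of F] by (simp add: subtopology_subtopology inf.absorb2)
    have top: "topspace (subtopology (zariski n) (Z F)) = Z F"
      using X sub[of F] by (auto simp: topspace_zariski)
    have "t0 \<in> param_box C t0 F" using t0 F by (auto simp: param_box_def)
    then have ne: "Z F \<noteq> {}" using phi_Z F by blast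
    have "Y1 = Z F \<or> Y2 = Z F"
      if Y: "closedin (subtopology (zariski n) (Z F)) Y1" "closedin (subtopology (zariski n) (Z F)) Y2"
        "Z F = Y1 \<union> Y2" for Y1 Y2
    proof (rule ccontr)
      assume neq: "\<not> (Y1 = Z F \<or> Y2 = Z F)"
      have witness: "\<exists>f\<in>polynomial_functions n. (\<forall>B\<in>Y. f B = 0) \<and> (\<exists>t\<in>param_box C t0 F. f (\<phi> t) \<noteq> 0)"
        if Y: "closedin (subtopology (zariski n) (Z F)) Y" "Y \<subset> Z F" for Y
      proof -
        obtain A where A: "A \<in> Z F" "A \<notin> Y" using Y by blast
        moreover have "A \<in> carrier_mat n n" using A sub X by blast
        ultimately obtain f where "f \<in> polynomial_functions n" "\<And>B. B \<in> Y \<Longrightarrow> f B = 0" "f A \<noteq> 0"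
          using closed_separating_polynomial[OF Y(1)] by metis
        then show ?thesis using A unfolding Z_def by blast
      qed
      obtain f s where f: "f \<in> polynomial_functions n" "\<forall>B\<in>Y1. f B = 0"
        "s \<in> param_box C t0 F" "f (\<phi> s) \<noteq> 0" using witness[OF Y(1)] neq Y(3) by blast
      obtain g t where g: "g \<in> polynomial_functions n" "\<forall>B\<in>Y2. g B = 0"
        "t \<in> param_box C t0 F" "g (\<phi> t) \<noteq> 0" using witness[OF Y(2)] neq Y(3) by blast
      obtain r where r: "r \<in> param_box C t0 F" "f (\<phi> r) \<noteq> 0" "g (\<phi> r) \<noteq> 0"
        using param_box_common_nonzero[of F C "\<lambda>t. f (\<phi> t)" "\<lambda>t. g (\<phi> t)" s t0 t]
          finite_subset[OF F \<open>finite I\<close>] inf F univ[OF f(1)] univ[OF g(1)] f(3,4) g(3,4) by blast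
      then show False using phi_Z[OF r(1) F] Y(3) f(2) g(2) by blast
    qed
    then show ?thesis using ne unfolding eq irreducible_space_def top by blast
  qed
  obtain xs where xs: "set xs = I" "distinct xs" using finite_distinct_list[OF \<open>finite I\<close>] by blast
  define ps where "ps = sort_key \<kappa> xs"
  have ps: "set ps = I" "distinct ps" "sorted (map \<kappa> ps)" by (simp_all add: ps_def xs)
  then have len: "length ps = card I" using distinct_card by fastforce
  have take_sub: "set (take i ps) \<subseteq> I" for i using ps(1) set_take_subset by fast
  have step: "Z (set (take i ps)) \<subset> Z (set (take (Suc i) ps))" if i: "i < length ps" for i
  proof -
    let ?F = "set (take i ps)" and ?G = "set (take (Suc i) ps)" and ?p = "ps ! i"
    have G: "?G = insert ?p ?F" using i by (simp add: take_Suc_conv_app_nth)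
    have p: "?p \<in> I" using i ps(1) nth_mem by blast
    have "?F \<subseteq> {q\<in>I. q \<noteq> ?p \<and> \<kappa> q \<le> \<kappa> ?p}"
    proof
      fix q assume "q \<in> ?F"
      then obtain k where k: "k < i" "q = ps ! k" using i by (auto simp: in_set_conv_nth)
      then have "q \<noteq> ?p" using ps(2) i by (simp add: nth_eq_iff_index_eq)
      moreover have "\<kappa> q \<le> \<kappa> ?p"
        using sorted_nth_mono[OF ps(3), of k i] k i by simp
      moreover have "q \<in> I" using take_sub \<open>q \<in> ?F\<close> by blast
      ultimately show "q \<in> {q\<in>I. q \<noteq> ?p \<and> \<kappa> q \<le> \<kappa> ?p}" by simp
    qed
    then have box: "param_box C t0 ?F \<subseteq> param_box C t0 {q\<in>I. q \<noteq> ?p \<and> \<kappa> q \<le> \<kappa> ?p}"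
      by (rule box_mono) blast
    obtain f s where f: "f \<in> polynomial_functions n" "s \<in> C ?p" "f (\<phi> (t0(?p := s))) \<noteq> 0"
      "\<forall>t\<in>param_box C t0 {q\<in>I. q \<noteq> ?p \<and> \<kappa> q \<le> \<kappa> ?p}. f (\<phi> t) = 0"
      using sep[OF p] by blast
    have "t0(?p := s) \<in> param_box C t0 ?G"
      using f(2) t0 take_sub G by (auto simp: param_box_def)
    then have "\<phi> (t0(?p := s)) \<in> Z ?G" by (rule phi_Z[OF _ take_sub])
    moreover have "\<phi> (t0(?p := s)) \<notin> Z ?F" using f box unfolding Z_def by blast
    moreover have "Z ?F \<subseteq> Z ?G"
      using box_mono[of ?F ?G] G take_sub[of "Suc i"] unfolding Z_def by blast
    ultimately show ?thesis by blast
  qed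
  show ?thesis
    unfolding krull_dim_def
    by (rule Sup_upper, rule CollectI, rule exI[of _ "card I"], rule conjI[OF refl],
        rule exI[of _ "\<lambda>i. Z (set (take i ps))"])
      (use closed irr[OF take_sub] step len in auto)
qed

section \<open>Invertible upper triangular matrices\<close>

lemma upper_triangular_det_nonzero_iff:
  fixes b :: "'a::field mat"
  assumes "b \<in> carrier_mat n n" "upper_triangular b"
  shows "det b \<noteq> 0 \<longleftrightarrow> (\<forall>k<n. b $$ (k, k) \<noteq> 0)"
  using assms by (auto simp: det_upper_triangular[of b n] prod_list_zero_iff diag_mat_def)

lemma borel_subgroup_iff:
  fixes b :: "'a::field mat"
  shows "b \<in> borel_subgroup n \<longleftrightarrow>
    b \<in> carrier_mat n n \<and> upper_triangular b \<and> (\<forall>k<n. b $$ (k, k) \<noteq> 0)"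
proof (cases "b \<in> carrier_mat n n \<and> upper_triangular b")
  case True
  then have b: "b \<in> carrier_mat n n" "upper_triangular b" by simp_all
  have "invertible_mat b \<longleftrightarrow> det b \<noteq> 0"
  proof
    assume "invertible_mat b"
    then obtain B where B: "b * B = 1\<^sub>m n" "B * b = 1\<^sub>m (dim_row B)"
      using b by (auto simp: invertible_mat_def inverts_mat_def)
    have "dim_col (B * b) = dim_row B" "dim_col (b * B) = n" by (simp_all only: B index_one_mat)
    then have "B \<in> carrier_mat n n" using b by auto
    then have "det b * det B = 1" using det_mult[OF b(1), of B] B(1) by simp
    then show "det b \<noteq> 0" by auto
  next
    assume "det b \<noteq> 0"
    from det_non_zero_imp_unit[OF b(1) this, of "()"]
    obtain B where "B \<in> carrier_mat n n" "B * b = 1\<^sub>m n" "b * B = 1\<^sub>m n"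
      by (auto simp: Units_def ring_mat_simps)
    then show "invertible_mat b"
      using b by (auto simp: invertible_mat_def inverts_mat_def square_mat.simps)
  qed
  then show ?thesis
    using True upper_triangular_det_nonzero_iff[OF b] by (auto simp: borel_subgroup_def)
qed (auto simp: borel_subgroup_def)

lemma index_mult3:
  assumes "A \<in> carrier_mat n n" "x \<in> carrier_mat n n" "B \<in> carrier_mat n n" "r < n" "c < n"
  shows "(A * x * B) $$ (r, c) =
    (\<Sum>i<n. (\<Sum>k<n. A $$ (r, k) * x $$ (k, i)) * B $$ (i, c))"
  using assms by (simp add: scalar_prod_def atLeast0LessThan del: assoc_mult_mat)

section \<open>A parametrisation of the double coset by affine coordinates\<close>

text \<open>The one-line notation with columns numbered from \<open>0\<close> but rows still numbered from \<open>1\<close>: the rook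
of column \<open>c\<close> stands in the row with matrix index \<open>a c - 1\<close>, and \<open>a c = 0\<close> means that there is no
rook.\<close>
locale rook_placement =
  fixes n :: nat and a :: "nat \<Rightarrow> nat"
  assumes bound: "c < n \<Longrightarrow> a c \<le> n"
    and inj: "i < n \<Longrightarrow> j < n \<Longrightarrow> a i = a j \<Longrightarrow> 0 < a i \<Longrightarrow> i = j"
begin

definition rook_mat :: "'a::field mat" where
  "rook_mat = mat n n (\<lambda>(r, c). if a c = Suc r then 1 else 0)"

text \<open>\<open>Inl (r, c)\<close> is the parameter of the entry \<open>(r, c)\<close> of the left factor, \<open>Inr (i, c)\<close> that of the entry
\<open>(i, c)\<close> of the right factor. In the right cells, \<open>a c \<le> a i\<close> excludes exactly the coinversion pairs;
equality cannot occur, but empty columns \<open>c\<close> are included.\<close>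
definition left_cells :: "(nat \<times> nat) set" where
  "left_cells = {(r, c). c < n \<and> r < a c}"

definition right_cells :: "(nat \<times> nat) set" where
  "right_cells = {(i, c). i < c \<and> c < n \<and> 0 < a i \<and> a c \<le> a i}"

definition cells :: "(nat \<times> nat + nat \<times> nat) set" where
  "cells = left_cells <+> right_cells"

definition left_entry :: "(nat \<times> nat + nat \<times> nat \<Rightarrow> 'a::field) \<Rightarrow> nat \<Rightarrow> nat \<Rightarrow> 'a" where
  "left_entry t r c = (if r < a c then t (Inl (r, c)) else 0)"

definition right_entry :: "(nat \<times> nat + nat \<times> nat \<Rightarrow> 'a::field) \<Rightarrow> nat \<Rightarrow> nat \<Rightarrow> 'a" where
  "right_entry t i c =
    (if i = c then 1 else if (i, c) \<in> right_cells then t (Inr (i, c)) else 0)"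

definition cell_map :: "(nat \<times> nat + nat \<times> nat \<Rightarrow> 'a::field) \<Rightarrow> 'a mat" where
  "cell_map t = mat n n (\<lambda>(r, c). \<Sum>i<n. left_entry t r i * right_entry t i c)"

lemma cell_map_index:
  "r < n \<Longrightarrow> c < n \<Longrightarrow> cell_map t $$ (r, c) = (\<Sum>i<n. left_entry t r i * right_entry t i c)"
  by (simp add: cell_map_def)

lemma cell_map_carrier: "cell_map t \<in> carrier_mat n n"
  by (simp add: cell_map_def)

lemma rook_mat_carrier: "rook_mat \<in> carrier_mat n n"
  by (simp add: rook_mat_def)

lemma sum_times_rook_mat:
  assumes "i < n"
  shows "(\<Sum>k<n. f k * rook_mat $$ (k, i)) = (if 0 < a i then f (a i - 1) else (0::'a::field))"
proof (cases "0 < a i")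
  case True
  have "(\<Sum>k<n. f k * rook_mat $$ (k, i)) = (\<Sum>k\<in>{a i - 1}. f k * rook_mat $$ (k, i))"
    using True bound[OF assms] assms
    by (intro sum.mono_neutral_right) (auto simp: rook_mat_def)
  also have "\<dots> = f (a i - 1)"
    using True bound[OF assms] assms by (simp add: rook_mat_def)
  finally show ?thesis using True by simp
next
  case False
  then show ?thesis using assms by (simp add: rook_mat_def)
qed

lemma finite_left_cells: "finite left_cells"
proof (rule finite_subset)
  show "left_cells \<subseteq> {..<n} \<times> {..<n}" using bound by (fastforce simp: left_cells_def)
qed simp

lemma finite_right_cells: "finite right_cells"
  by (rule finite_subset[of _ "{..<n} \<times> {..<n}"]) (auto simp: right_cells_def)

lemma finite_cells: "finite cells"
  by (simp add: cells_def finite_left_cells finite_right_cells)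

text \<open>The left factor is \<open>b * rook_mat\<close>, where \<open>b\<close> has column \<open>c\<close> of the left factor as its
column \<open>a c - 1\<close>, and unit vectors as the columns whose index is not the row of a rook. The diagonal
of \<open>b\<close> then consists of the parameters at the rooks, and of ones.\<close>
lemma cell_map_in_double_coset:
  assumes rook: "\<And>c. c < n \<Longrightarrow> 0 < a c \<Longrightarrow> t (Inl (a c - 1, c)) \<noteq> (0::'a::field)"
  shows "cell_map t \<in> double_coset n rook_mat"
proof -
  define col where "col k = (SOME c. c < n \<and> a c = Suc k)" for k
  have col: "col k < n \<and> a (col k) = Suc k" if "\<exists>c<n. a c = Suc k" for k
    unfolding col_def using someI_ex[OF that] .
  have col_eq: "col (a c - 1) = c" if "c < n" "0 < a c" for c
  proof -
    have "\<exists>c'<n. a c' = Suc (a c - 1)" using that by auto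
    from col[OF this] show ?thesis using that inj[of "col (a c - 1)" c] by simp
  qed
  define b where "b = mat n n (\<lambda>(r, k). if \<exists>c<n. a c = Suc k then left_entry t r (col k)
    else if r = k then 1 else 0)"
  define b' where "b' = mat n n (\<lambda>(i, c). right_entry t i c)"
  have carrier: "b \<in> carrier_mat n n" "b' \<in> carrier_mat n n" by (simp_all add: b_def b'_def)
  have "b $$ (k, k) \<noteq> 0" if "k < n" for k
  proof (cases "\<exists>c<n. a c = Suc k")
    case True
    then show ?thesis using that col[OF True] rook[of "col k"] by (simp add: b_def left_entry_def)
  next
    case False
    then show ?thesis using that by (auto simp: b_def)
  qed
  moreover have "upper_triangular b"
    using col by (intro upper_triangularI) (auto simp: b_def left_entry_def)
  ultimately have b: "b \<in> borel_subgroup n"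
    using carrier by (simp add: borel_subgroup_iff)
  have b': "b' \<in> borel_subgroup n"
    unfolding borel_subgroup_iff
    by (auto simp: b'_def right_entry_def right_cells_def intro!: upper_triangularI)
  have "cell_map t = b * rook_mat * b'"
  proof (rule eq_matI)
    fix r c assume "r < dim_row (b * rook_mat * b')" "c < dim_col (b * rook_mat * b')"
    then have rc: "r < n" "c < n" using carrier by auto
    have "(\<Sum>k<n. b $$ (r, k) * rook_mat $$ (k, i)) = left_entry t r i" if "i < n" for i
    proof (cases "0 < a i")
      case True
      then have "\<exists>c<n. a c = Suc (a i - 1)" using that by auto
      then show ?thesis
        using True that rc bound[OF that] col_eq[OF that True]
        by (simp add: sum_times_rook_mat b_def)
    next
      case False
      then show ?thesis using that by (simp add: sum_times_rook_mat left_entry_def)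
    qed
    moreover have "b' $$ (i, c) = right_entry t i c" if "i < n" for i
      using that rc by (simp add: b'_def)
    ultimately show "cell_map t $$ (r, c) = (b * rook_mat * b') $$ (r, c)"
      using rc by (simp add: index_mult3[OF carrier(1) rook_mat_carrier carrier(2)]
          cell_map_index)
  qed (use carrier cell_map_carrier in auto)
  then show ?thesis using b b' unfolding double_coset_def by blast
qed

text \<open>The shapes of \<open>b * rook_mat\<close> and of an element of the Borel subgroup, and the normal form of the latter
in its first \<open>m\<close> columns.\<close>
definition left_supported :: "(nat \<Rightarrow> nat \<Rightarrow> 'a::field) \<Rightarrow> bool" where
  "left_supported M \<longleftrightarrow> (\<forall>c<n. \<forall>r\<ge>a c. M r c = 0)"

definition borel_shaped :: "(nat \<Rightarrow> nat \<Rightarrow> 'a::field) \<Rightarrow> bool" where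
  "borel_shaped V \<longleftrightarrow> (\<forall>i<n. (\<forall>c<i. V i c = 0) \<and> V i i \<noteq> 0)"

definition reduced_upto :: "nat \<Rightarrow> (nat \<Rightarrow> nat \<Rightarrow> 'a::field) \<Rightarrow> bool" where
  "reduced_upto m V \<longleftrightarrow>
    (\<forall>c<m. 0 < a c \<longrightarrow> V c c = 1 \<and> (\<forall>i<c. a i < a c \<longrightarrow> V i c = 0))"

text \<open>To clear column \<open>m\<close> of \<open>V\<close>, subtract multiples of row \<open>m\<close> from the rows \<open>i < m\<close> with
\<open>a i < a m\<close>, and scale row \<open>m\<close>. Row \<open>m\<close> starts at column \<open>m\<close>, so the columns done before are
preserved. The inverse operation on \<open>M\<close> adds multiples of such columns \<open>i\<close> to column \<open>m\<close>; as these
columns live in the first \<open>a i < a m\<close> rows, the shape of \<open>M\<close> survives.\<close>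
lemma column_elimination:
  fixes M V :: "nat \<Rightarrow> nat \<Rightarrow> 'a::field"
  assumes "m \<le> n" and "left_supported M" and "borel_shaped V"
  shows "\<exists>M' V'. left_supported M' \<and> borel_shaped V' \<and> reduced_upto m V' \<and>
    (\<forall>r c. (\<Sum>i<n. M' r i * V' i c) = (\<Sum>i<n. M r i * V i c))"
  using \<open>m \<le> n\<close>
proof (induction m)
  case 0
  show ?case using assms(2,3) by (auto simp: reduced_upto_def)
next
  case (Suc m)
  then have m: "m < n" by simp
  with Suc obtain M' V' where IH: "left_supported M'" "borel_shaped V'" "reduced_upto m V'"
    and prod: "\<And>r c. (\<Sum>i<n. M' r i * V' i c) = (\<Sum>i<n. M r i * V i c)"
    by (meson less_imp_le)
  have M': "\<And>r c. c < n \<Longrightarrow> a c \<le> r \<Longrightarrow> M' r c = 0"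
    using IH(1) unfolding left_supported_def by blast
  have V': "\<And>i c. c < i \<Longrightarrow> i < n \<Longrightarrow> V' i c = 0" "\<And>c. c < n \<Longrightarrow> V' c c \<noteq> 0"
    using IH(2) unfolding borel_shaped_def by blast+
  have red: "\<And>c. c < m \<Longrightarrow> 0 < a c \<Longrightarrow> V' c c = 1"
    "\<And>i c. c < m \<Longrightarrow> 0 < a c \<Longrightarrow> i < c \<Longrightarrow> a i < a c \<Longrightarrow> V' i c = 0"
    using IH(3) unfolding reduced_upto_def by blast+
  show ?case
  proof (cases "0 < a m")
    case False
    then have "reduced_upto (Suc m) V'"
      using IH(3) by (auto simp: reduced_upto_def less_Suc_eq)
    with IH prod show ?thesis by blast
  next
    case True
    define v where "v = V' m m"
    have v: "v \<noteq> 0" using V'(2) m by (simp add: v_def)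
    \<comment> \<open>\<open>V\<close> is multiplied on the left by \<open>1 - w e\<^sub>m\<^sup>T\<close>, and \<open>M\<close> on the right by its inverse, which is
      \<open>1 + v w e\<^sub>m\<^sup>T\<close> because \<open>1 - w m = 1 / v\<close>.\<close>
    define w where "w i = (if i = m then 1 - 1 / v else if i < m \<and> a i < a m then V' i m / v else 0)"
      for i
    define V'' where "V'' i c = V' i c - w i * V' m c" for i c
    define M'' where "M'' r c = (if c = m then M' r m + (\<Sum>i<n. M' r i * w i) * v else M' r c)"
      for r c
    have w0: "w i = 0" if "m < i" for i using that by (simp add: w_def)
    have row: "V' m c = 0" if "c < m" for c using V'(1) that m by blast
    have V''m: "V'' m c = V' m c / v" for c by (simp add: V''_def w_def field_simps)
    have prod': "(\<Sum>i<n. M'' r i * V'' i c) = (\<Sum>i<n. M r i * V i c)" for r c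
    proof -
      have "(\<Sum>i<n. M'' r i * V'' i c) = (\<Sum>i<n. M' r i * V'' i c +
          (if i = m then (\<Sum>i<n. M' r i * w i) * v * V'' i c else 0))"
        by (intro sum.cong) (auto simp: M''_def algebra_simps)
      also have "\<dots> = (\<Sum>i<n. M' r i * V'' i c) + (\<Sum>i<n. M' r i * w i) * v * V'' m c"
        using m by (simp add: sum.distrib sum.delta)
      also have "(\<Sum>i<n. M' r i * V'' i c) =
          (\<Sum>i<n. M' r i * V' i c) - (\<Sum>i<n. M' r i * w i) * V' m c"
        by (simp add: V''_def right_diff_distrib sum_subtractf sum_distrib_right mult.assoc)
      also have "(\<Sum>i<n. M' r i * w i) * v * V'' m c = (\<Sum>i<n. M' r i * w i) * V' m c"
        using v by (simp add: V''m)
      finally show ?thesis by (simp add: prod)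
    qed
    have M''0: "M'' r c = 0" if "c < n" "a c \<le> r" for r c
    proof (cases "c = m")
      case c: True
      have "M' r i * w i = 0" if "i < n" for i
        using M'[of i r] that \<open>a c \<le> r\<close> c by (auto simp: w_def)
      then have "(\<Sum>i<n. M' r i * w i) = 0" by (intro sum.neutral) blast
      then show ?thesis using c M'[of m r] that by (simp add: M''_def)
    qed (use that M' in \<open>simp add: M''_def\<close>)
    have V''0: "V'' i c = 0" if "c < i" "i < n" for i c
      using that V'(1)[of c i] row[of c] w0[of i] by (cases "c < m") (auto simp: V''_def)
    have V''d: "V'' c c \<noteq> 0" if "c < n" for c
    proof (cases c m rule: linorder_cases)
      case less
      then show ?thesis using that V'(2) row by (simp add: V''_def)
    next
      case equal
      then show ?thesis using V''m[of m] v by (simp add: v_def)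
    next
      case greater
      then show ?thesis using that V'(2) w0 by (simp add: V''_def)
    qed
    have red1: "V'' c c = 1" if "c < Suc m" "0 < a c" for c
      using that red(1)[of c] row[of c] V''m[of m] v by (auto simp: less_Suc_eq V''_def v_def)
    have red2: "V'' i c = 0" if "c < Suc m" "0 < a c" "i < c" "a i < a c" for i c
      using that red(2)[of c i] row[of c] v by (auto simp: less_Suc_eq V''_def w_def v_def)
    have "left_supported M''" using M''0 by (simp add: left_supported_def)
    moreover have "borel_shaped V''" using V''0 V''d by (simp add: borel_shaped_def)
    moreover have "reduced_upto (Suc m) V''" using red1 red2 by (simp add: reduced_upto_def)
    ultimately show ?thesis using prod' by blast
  qed
qed

text \<open>After the elimination in all columns, the entries of \<open>V\<close> that are not prescribed are those in right
cells and those in rows \<open>i\<close> with \<open>a i = 0\<close>; the latter are multiplied by the zero column \<open>i\<close> of \<open>M\<close>.\<close>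
lemma double_coset_subset_range:
  "double_coset n (rook_mat :: 'a::field mat) \<subseteq> range cell_map"
proof
  fix A :: "'a mat" assume "A \<in> double_coset n rook_mat"
  then obtain b b' where A: "A = b * rook_mat * b'" and B: "b \<in> borel_subgroup n" "b' \<in> borel_subgroup n"
    unfolding double_coset_def by blast
  then have b: "b \<in> carrier_mat n n" "\<And>i j. j < i \<Longrightarrow> i < n \<Longrightarrow> b $$ (i, j) = 0"
    and b': "b' \<in> carrier_mat n n" "\<And>i j. j < i \<Longrightarrow> i < n \<Longrightarrow> b' $$ (i, j) = 0"
      "\<And>c. c < n \<Longrightarrow> b' $$ (c, c) \<noteq> 0"
    by (auto simp: borel_subgroup_iff dest: upper_triangularD)
  define M where "M r i = (if r < n then \<Sum>k<n. b $$ (r, k) * rook_mat $$ (k, i) else 0)" for r i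
  have "M r c = 0" if "c < n" "a c \<le> r" for r c
    using b(2)[of "a c - 1" r] that by (auto simp: M_def sum_times_rook_mat)
  then have "left_supported M" by (simp add: left_supported_def)
  moreover have "borel_shaped (\<lambda>i c. b' $$ (i, c))"
    using b' by (simp add: borel_shaped_def)
  ultimately obtain M' V' where *: "left_supported M'" "borel_shaped V'" "reduced_upto n V'"
    and prod: "\<And>r c. (\<Sum>i<n. M' r i * V' i c) = (\<Sum>i<n. M r i * b' $$ (i, c))"
    using column_elimination[OF order.refl, of M "\<lambda>i c. b' $$ (i, c)"] by blast
  have M': "\<And>r c. c < n \<Longrightarrow> a c \<le> r \<Longrightarrow> M' r c = 0"
    using *(1) unfolding left_supported_def by blast
  have V': "\<And>i c. c < i \<Longrightarrow> i < n \<Longrightarrow> V' i c = 0"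
    using *(2) unfolding borel_shaped_def by blast
  have red: "\<And>c. c < n \<Longrightarrow> 0 < a c \<Longrightarrow> V' c c = 1"
    "\<And>i c. c < n \<Longrightarrow> 0 < a c \<Longrightarrow> i < c \<Longrightarrow> a i < a c \<Longrightarrow> V' i c = 0"
    using *(3) unfolding reduced_upto_def by blast+
  define t where "t p = (case p of Inl (r, c) \<Rightarrow> M' r c | Inr (i, c) \<Rightarrow> V' i c)" for p
  have "A = cell_map t"
  proof (rule eq_matI)
    fix r c assume "r < dim_row (cell_map t)" "c < dim_col (cell_map t)"
    then have rc: "r < n" "c < n" using cell_map_carrier[of t] by auto
    have summand: "left_entry t r i * right_entry t i c = M' r i * V' i c" if i: "i < n" for i
    proof (cases "r < a i")
      case False
      then show ?thesis using M'[of i r] i by (simp add: left_entry_def)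
    next
      case True
      then have ai: "0 < a i" by simp
      have "right_entry t i c = V' i c"
      proof (cases i c rule: linorder_cases)
        case less
        then show ?thesis
          using ai rc red(2)[of c i] by (cases "a i < a c")
            (auto simp: right_entry_def right_cells_def t_def)
      next
        case equal
        then show ?thesis using red(1)[of c] ai rc by (simp add: right_entry_def)
      next
        case greater
        then show ?thesis using V'[of c i] i by (simp add: right_entry_def right_cells_def)
      qed
      then show ?thesis using True by (simp add: left_entry_def t_def)
    qed
    have "A $$ (r, c) = (\<Sum>i<n. M r i * b' $$ (i, c))"
      unfolding A using rc by (simp add: index_mult3[OF b(1) rook_mat_carrier b'(1)] M_def)
    also have "\<dots> = cell_map t $$ (r, c)"
      using rc by (simp add: cell_map_index summand flip: prod)
    finally show "A $$ (r, c) = cell_map t $$ (r, c)" .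
  qed (use A b b' cell_map_carrier[of t] in auto)
  then show "A \<in> range cell_map" by blast
qed

lemma double_coset_carrier: "double_coset n (rook_mat :: 'a::field mat) \<subseteq> carrier_mat n n"
  using double_coset_subset_range cell_map_carrier by blast

lemma cell_map_entry_polys:
  assumes "r < n" "c < n"
  shows "(\<lambda>t. cell_map t $$ (r, c) :: 'a::field) \<in> polys_upto cells (1 + 1)"
proof -
  have left: "(\<lambda>t. left_entry t r i :: 'a) \<in> polys_upto cells 1" if "i < n" for i
  proof (cases "r < a i")
    case True
    then have "Inl (r, i) \<in> cells" using that by (auto simp: cells_def left_cells_def)
    from polys_upto_coord[OF finite_cells this] show ?thesis
      using True by (simp add: left_entry_def)
  qed (simp add: left_entry_def polys_upto_const)
  have right: "(\<lambda>t. right_entry t i c :: 'a) \<in> polys_upto cells 1" for i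
  proof (cases "i \<noteq> c \<and> (i, c) \<in> right_cells")
    case True
    then have "Inr (i, c) \<in> cells" by (auto simp: cells_def)
    from polys_upto_coord[OF finite_cells this] show ?thesis
      using True by (simp add: right_entry_def)
  next
    case False
    then have "(\<lambda>t. right_entry t i c) = (\<lambda>t. if i = c then 1 else 0 :: 'a)"
      by (auto simp: right_entry_def)
    then show ?thesis by (simp only: polys_upto_const)
  qed
  have "(\<lambda>t. \<Sum>i<n. left_entry t r i * right_entry t i c :: 'a) \<in> polys_upto cells (1 + 1)"
    using left right by (intro polys_upto_sum polys_upto_mult) auto
  then show ?thesis by (simp add: cell_map_index assms)
qed

text \<open>Along a coordinate line each entry of the two factors is constant or the coordinate itself.\<close>
lemma cell_map_univariate:
  assumes "f \<in> polynomial_functions n"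
  shows "\<exists>q. \<forall>s. f (cell_map (t(p := s))) = poly q (s::'a::field)"
  using assms
proof induction
  case (const c)
  show ?case by (rule exI[of _ "[:c:]"]) simp
next
  case (coord r c)
  define l where "l i = (if r < a i then if p = Inl (r, i) then [:0, 1:] else [:t (Inl (r, i)):] else 0)"
    for i
  define u where "u i = (if i = c then 1 else if (i, c) \<in> right_cells
    then if p = Inr (i, c) then [:0, 1:] else [:t (Inr (i, c)):] else 0)" for i
  have "left_entry (t(p := s)) r i = poly (l i) s" "right_entry (t(p := s)) i c = poly (u i) s" for i s
    by (auto simp: left_entry_def right_entry_def l_def u_def)
  then have "\<forall>s. cell_map (t(p := s)) $$ (r, c) = poly (\<Sum>i<n. l i * u i) s"
    using coord by (simp add: cell_map_index poly_sum)
  then show ?case by blast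
next
  case (add f g)
  then obtain q1 q2 where "\<forall>s. f (cell_map (t(p := s))) = poly q1 s"
    "\<forall>s. g (cell_map (t(p := s))) = poly q2 s" by blast
  then show ?case by (intro exI[of _ "q1 + q2"]) (simp del: fun_upd_apply)
next
  case (mult f g)
  then obtain q1 q2 where "\<forall>s. f (cell_map (t(p := s))) = poly q1 s"
    "\<forall>s. g (cell_map (t(p := s))) = poly q2 s" by blast
  then show ?case by (intro exI[of _ "q1 * q2"]) (simp del: fun_upd_apply)
qed

text \<open>The parameter values of the rook matrix itself.\<close>
definition base_point :: "nat \<times> nat + nat \<times> nat \<Rightarrow> 'a::field" where
  "base_point p = (case p of Inl (r, c) \<Rightarrow> if a c = Suc r then 1 else 0 | Inr _ \<Rightarrow> 0)"

definition value_set :: "nat \<times> nat + nat \<times> nat \<Rightarrow> 'a::field set" where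
  "value_set p = (case p of Inl (r, c) \<Rightarrow> if a c = Suc r then - {0} else UNIV | Inr _ \<Rightarrow> UNIV)"

text \<open>Parameters of the right factor are released first, then the columns of the left factor from right
to left.\<close>
definition level :: "nat \<times> nat + nat \<times> nat \<Rightarrow> nat" where
  "level p = (case p of Inl (r, c) \<Rightarrow> n - c | Inr _ \<Rightarrow> 0)"

text \<open>The entry \<open>(r, c)\<close> of the product is the parameter plus terms \<open>M r i * V i c\<close> with \<open>i < c\<close>. When
row \<open>r\<close> has its initial values to the left of \<open>c\<close>, \<open>M r i \<noteq> 0\<close> only if the rook of column \<open>i\<close>
stands in row \<open>r\<close>, so that \<open>a i = r + 1 \<le> a c\<close>, and even \<open>a i < a c\<close> because \<open>i \<noteq> c\<close>.
But then \<open>V i c = 0\<close>, since \<open>(i, c)\<close> is not a right cell.\<close>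
lemma cell_map_left_coordinate:
  assumes rc: "(r, c) \<in> left_cells"
    and base: "\<And>i. i < c \<Longrightarrow> t (Inl (r, i)) = base_point (Inl (r, i))"
  shows "cell_map t $$ (r, c) = (t (Inl (r, c)) :: 'a::field)"
proof -
  have c: "c < n" "r < a c" using rc by (auto simp: left_cells_def)
  then have r: "r < n" using bound[of c] by simp
  have "left_entry t r i * right_entry t i c = 0" if "i < n" "i \<noteq> c" for i
  proof (rule ccontr)
    assume "left_entry t r i * right_entry t i c \<noteq> 0"
    then have "(i, c) \<in> right_cells" "r < a i" "t (Inl (r, i)) \<noteq> 0"
      using that by (auto simp: left_entry_def right_entry_def split: if_splits)
    moreover from this have "a i = Suc r"
      using base[of i] by (auto simp: base_point_def right_cells_def split: if_splits)
    ultimately have "a i = a c" using c by (auto simp: right_cells_def)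
    then show False using inj[of i c] that c by simp
  qed
  then have "cell_map t $$ (r, c) = (\<Sum>i\<in>{c}. left_entry t r i * right_entry t i c)"
    unfolding cell_map_index[OF r c(1)] using c by (intro sum.mono_neutral_right) auto
  then show ?thesis using c by (simp add: left_entry_def right_entry_def)
qed

lemma cell_map_right_coordinate:
  assumes ic: "(i, c) \<in> right_cells"
    and base: "\<And>r c. t (Inl (r, c)) = base_point (Inl (r, c))"
  shows "cell_map t $$ (a i - 1, c) = (t (Inr (i, c)) :: 'a::field)"
proof -
  have i: "i < c" "c < n" "0 < a i" "a c \<le> a i" using ic by (auto simp: right_cells_def)
  then have r: "a i - 1 < n" using bound[of i] by simp
  have "left_entry t (a i - 1) j = (if j = i then 1 else 0)" if "j < n" for j
    using i that inj[of i j] by (auto simp: left_entry_def base base_point_def)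
  then have "cell_map t $$ (a i - 1, c) = (\<Sum>j<n. if j = i then right_entry t j c else 0)"
    unfolding cell_map_index[OF r i(2)] by (intro sum.cong) auto
  also have "\<dots> = right_entry t i c" using i by simp
  also have "\<dots> = t (Inr (i, c))" using ic i by (simp add: right_entry_def)
  finally show ?thesis .
qed

text \<open>Both bounds apply to the same parametrisation. For the upper bound \<open>cell_map\<close> has to cover the
double coset, and it may leave it; for the lower bound it has to stay inside, which is why the
parameters at the rooks avoid \<open>0\<close>.\<close>
lemma orbit_dim_rook_mat:
  assumes inf: "infinite (UNIV :: 'a::field set)"
  shows "orbit_dim n (rook_mat :: 'a mat) = enat (card cells)"
proof (rule antisym)
  show "orbit_dim n (rook_mat :: 'a mat) \<le> enat (card cells)"
    unfolding orbit_dim_def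
    by (rule krull_dim_le_parameters[OF finite_cells cell_map_entry_polys
          double_coset_carrier double_coset_subset_range])
  let ?C = "value_set :: _ \<Rightarrow> 'a set"
  show "enat (card cells) \<le> orbit_dim n (rook_mat :: 'a mat)"
    unfolding orbit_dim_def
  proof (rule krull_dim_ge_parameters[where C = ?C and ?t0.0 = base_point and \<kappa> = level
        and \<phi> = cell_map, OF finite_cells double_coset_carrier])
    have inf0: "infinite (- {0::'a})" using inf by (simp add: Compl_eq_Diff_UNIV)
    then show "infinite (?C p)" for p
      using inf by (auto simp: value_set_def split: sum.split prod.split)
    show "base_point p \<in> ?C p" for p
      by (auto simp: value_set_def base_point_def split: sum.split prod.split)
    show "cell_map t \<in> double_coset n rook_mat" if t: "t \<in> param_box ?C base_point cells" for t
    proof (rule cell_map_in_double_coset)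
      fix c assume c: "c < n" "0 < a c"
      then have "Inl (a c - 1, c) \<in> cells" by (auto simp: cells_def left_cells_def)
      then have "t (Inl (a c - 1, c)) \<in> ?C (Inl (a c - 1, c))"
        using t by (simp add: param_box_def)
      then show "t (Inl (a c - 1, c)) \<noteq> 0" using c by (simp add: value_set_def)
    qed
    show "\<exists>q. \<forall>s. f (cell_map (t(p := s))) = poly q s" if "f \<in> polynomial_functions n"
      for f and t :: "_ \<Rightarrow> 'a" and p
      using cell_map_univariate[OF that] .
    fix p :: "nat \<times> nat + nat \<times> nat" assume p: "p \<in> cells"
    let ?box = "param_box ?C base_point {q \<in> cells. q \<noteq> p \<and> level q \<le> level p}"
    have "\<exists>f\<in>polynomial_functions n. (\<forall>t\<in>?box. f (cell_map t) = t p - base_point p) \<and>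
      (\<forall>s. f (cell_map (base_point(p := s))) = s - base_point p)"
    proof (cases p)
      case (Inl rc)
      then obtain r c where p_eq: "p = Inl (r, c)" and rc: "(r, c) \<in> left_cells"
        using p by (cases rc) (auto simp: cells_def)
      then have "c < n" "r < n" using bound[of c] by (auto simp: left_cells_def)
      show ?thesis
      proof (intro bexI conjI ballI allI)
        show "(\<lambda>A. A $$ (r, c) + - base_point p) \<in> polynomial_functions n"
          using \<open>c < n\<close> \<open>r < n\<close> by (intro polynomial_functions.intros)
        fix t assume t: "t \<in> ?box"
        have "t (Inl (r, i)) = base_point (Inl (r, i))" if "i < c" for i
          by (rule param_box_fixed[OF t]) (use that \<open>c < n\<close> in \<open>auto simp: p_eq level_def\<close>)
        then show "cell_map t $$ (r, c) + - base_point p = t p - base_point p"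
          using cell_map_left_coordinate[OF rc, of t] p_eq by simp
      next
        fix s :: 'a
        show "cell_map (base_point(p := s)) $$ (r, c) + - base_point p = s - base_point p"
          using cell_map_left_coordinate[OF rc, of "base_point(p := s)"] p_eq by simp
      qed
    next
      case (Inr ic)
      then obtain i c where p_eq: "p = Inr (i, c)" and ic: "(i, c) \<in> right_cells"
        using p by (cases ic) (auto simp: cells_def)
      then have "c < n" "a i - 1 < n" using bound[of i] by (auto simp: right_cells_def)
      show ?thesis
      proof (intro bexI conjI ballI allI)
        show "(\<lambda>A. A $$ (a i - 1, c) + - base_point p) \<in> polynomial_functions n"
          using \<open>c < n\<close> \<open>a i - 1 < n\<close> by (intro polynomial_functions.intros)
        fix t assume t: "t \<in> ?box"
        have "t (Inl (r', c')) = base_point (Inl (r', c'))" for r' c'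
          by (rule param_box_fixed[OF t]) (auto simp: p_eq level_def cells_def left_cells_def)
        then show "cell_map t $$ (a i - 1, c) + - base_point p = t p - base_point p"
          using cell_map_right_coordinate[OF ic, of t] p_eq by simp
      next
        fix s :: 'a
        show "cell_map (base_point(p := s)) $$ (a i - 1, c) + - base_point p = s - base_point p"
          using cell_map_right_coordinate[OF ic, of "base_point(p := s)"] p_eq by simp
      qed
    qed
    then obtain f where f: "f \<in> polynomial_functions n"
      "\<And>t. t \<in> ?box \<Longrightarrow> f (cell_map t) = t p - base_point p"
      "\<And>s. f (cell_map (base_point(p := s))) = s - base_point p" by blast
    have "t p = base_point p" if "t \<in> ?box" for t by (rule param_box_fixed[OF that]) simp
    moreover obtain s where "s \<in> ?C p" "s \<noteq> base_point p"
    proof -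
      have "infinite (?C p - {base_point p})"
        using inf inf0 by (auto simp: value_set_def split: sum.split prod.split)
      then have "?C p - {base_point p} \<noteq> {}" by (metis finite.emptyI)
      with that show ?thesis by blast
    qed
    ultimately show "\<exists>f\<in>polynomial_functions n. (\<forall>t\<in>?box. f (cell_map t) = 0) \<and>
        (\<exists>s\<in>?C p. f (cell_map (base_point(p := s))) \<noteq> 0)"
      using f by (intro bexI[of _ f]) auto
  qed
qed

section \<open>Counting the parameters\<close>

lemma card_left_cells: "card left_cells = (\<Sum>c<n. a c)"
proof -
  have "left_cells = prod.swap ` (SIGMA c:{..<n}. {..<a c})"
    by (auto simp: left_cells_def image_iff)
  then show ?thesis by (simp add: card_image)
qed

text \<open>Together with the coinversion pairs, the right cells fill all positions \<open>(i, c)\<close> to the right of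
the diagonal with \<open>a i > 0\<close>.\<close>
lemma card_right_cells:
  "card right_cells + card {(i, c). i < c \<and> c < n \<and> 0 < a i \<and> a i < a c} =
    (\<Sum>i<n. if 0 < a i then n - Suc i else 0)"
proof -
  let ?N = "{(i, c). i < c \<and> c < n \<and> 0 < a i \<and> a i < a c}"
  have "finite ?N" by (rule finite_subset[of _ "{..<n} \<times> {..<n}"]) auto
  then have "card right_cells + card ?N = card (right_cells \<union> ?N)"
    by (subst card_Un_disjoint[OF finite_right_cells]) (auto simp: right_cells_def)
  also have "right_cells \<union> ?N = (SIGMA i:{..<n}. if 0 < a i then {Suc i..<n} else {})"
    by (auto simp: right_cells_def split: if_splits)
  also have "card \<dots> = (\<Sum>i<n. if 0 < a i then n - Suc i else 0)"
    by (subst card_SigmaI) (auto intro!: sum.cong)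
  finally show ?thesis .
qed

lemma card_cells:
  "int (card cells) = (\<Sum>i<n. if 0 < a i then int (a i) + int n - int (Suc i) else 0) -
    int (card {(i, c). i < c \<and> c < n \<and> 0 < a i \<and> a i < a c})"
proof -
  have "card cells = card left_cells + card right_cells"
    by (simp add: cells_def card_Plus finite_left_cells finite_right_cells)
  then have "int (card cells) + int (card {(i, c). i < c \<and> c < n \<and> 0 < a i \<and> a i < a c}) =
    (\<Sum>i<n. int (a i)) + (\<Sum>i<n. int (if 0 < a i then n - Suc i else 0))"
    using card_left_cells arg_cong[OF card_right_cells, of int] by simp
  also have "\<dots> = (\<Sum>i<n. if 0 < a i then int (a i) + int n - int (Suc i) else 0)"
    unfolding sum.distrib[symmetric] by (intro sum.cong) (auto simp: of_nat_diff)
  finally show ?thesis by simp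
qed

end

lemma rook_monoid_one_line:
  fixes x :: "'a::field mat"
  assumes x: "x \<in> rook_monoid n"
  defines "a \<equiv> \<lambda>j. one_line n x (Suc j)"
  shows "rook_placement n a" and "x = rook_placement.rook_mat n a"
proof -
  have a_Suc: "a c = Suc k" if "x $$ (k, c) = 1" "k < n" "c < n" for k c
  proof -
    have "(THE i. i \<in> {1..n} \<and> x $$ (i - 1, c) = 1) = Suc k"
    proof (rule the_equality)
      fix i assume i: "i \<in> {1..n} \<and> x $$ (i - 1, c) = 1"
      then have "i - 1 = k" using x that unfolding rook_monoid_def by force
      then show "i = Suc k" using i by auto
    qed (use that in auto)
    moreover have "\<exists>i\<in>{1..n}. x $$ (i - 1, c) = 1"
      using that by (intro bexI[of _ "Suc k"]) auto
    ultimately show ?thesis by (simp add: a_def one_line_def)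
  qed
  have a_cases: "a c = 0 \<or> (\<exists>k<n. a c = Suc k \<and> x $$ (k, c) = 1)" if "c < n" for c
  proof (cases "\<exists>i\<in>{1..n}. x $$ (i - 1, c) = 1")
    case True
    then obtain i where "i \<in> {1..n}" "x $$ (i - 1, c) = 1" by blast
    then have "i - 1 < n" "x $$ (i - 1, c) = 1" by auto
    with a_Suc[of "i - 1" c] that show ?thesis by blast
  qed (simp add: a_def one_line_def)
  show rook: "rook_placement n a"
  proof
    show "a c \<le> n" if "c < n" for c using a_cases[OF that] by auto
    fix i j assume ij: "i < n" "j < n" "a i = a j" "0 < a i"
    then obtain k where "k < n" "x $$ (k, i) = 1" "x $$ (k, j) = 1"
      using a_cases[of i] a_cases[of j] by auto
    then show "i = j" using x ij unfolding rook_monoid_def by force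
  qed
  interpret rook_placement n a by (rule rook)
  show "x = rook_mat"
  proof (rule eq_matI)
    fix r c assume "r < dim_row (rook_mat :: 'a mat)" "c < dim_col (rook_mat :: 'a mat)"
    then have rc: "r < n" "c < n" by (simp_all add: rook_mat_def)
    have "x $$ (r, c) \<in> {0, 1}" using x rc by (auto simp: rook_monoid_def)
    then show "x $$ (r, c) = rook_mat $$ (r, c)"
      using rc a_Suc[of r c] a_cases[of c] by (auto simp: rook_mat_def)
  qed (use x in \<open>auto simp: rook_monoid_def rook_mat_def\<close>)
qed

theorem theorem1p7:
  fixes n :: nat and x :: "'a::alg_closed_field mat"
  assumes "n \<ge> 1" and "x \<in> rook_monoid n"
  shows "\<exists>d::nat. orbit_dim n x = enat d \<and>
           int d = (\<Sum>i=1..n. a_star n x i) - int (coinv n x)"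
proof -
  define a where "a j = one_line n x (Suc j)" for j
  interpret rook_placement n a
    unfolding a_def by (rule rook_monoid_one_line(1)[OF assms(2)])
  have "a = (\<lambda>j. one_line n x (Suc j))" by (simp add: a_def fun_eq_iff)
  then have x: "x = rook_mat"
    using rook_monoid_one_line(2)[OF assms(2)] by (simp only:)
  have star: "(\<Sum>i=1..n. a_star n x i) =
      (\<Sum>i<n. if 0 < a i then int (a i) + int n - int (Suc i) else 0)"
    unfolding One_nat_def sum.atLeast1_atMost_eq by (intro sum.cong) (auto simp: a_star_def a_def)
  have "{(i, j). 1 \<le> i \<and> i < j \<and> j \<le> n \<and> 0 < one_line n x i \<and> one_line n x i < one_line n x j} =
    map_prod Suc Suc ` {(i, c). i < c \<and> c < n \<and> 0 < a i \<and> a i < a c}" (is "?L = ?R")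
  proof (intro equalityI subsetI)
    fix p assume "p \<in> ?L"
    moreover obtain i j where "p = (i, j)" by fastforce
    ultimately have "p = map_prod Suc Suc (i - 1, j - 1)"
      "(i - 1, j - 1) \<in> {(i, c). i < c \<and> c < n \<and> 0 < a i \<and> a i < a c}"
      by (auto simp: a_def)
    then show "p \<in> ?R" by blast
  qed (auto simp: a_def)
  then have "coinv n x = card {(i, c). i < c \<and> c < n \<and> 0 < a i \<and> a i < a c}"
    unfolding coinv_def
    by (simp add: card_image inj_on_subset[OF prod.inj_map[OF inj_Suc inj_Suc] subset_UNIV])
  with star card_cells have "int (card cells) = (\<Sum>i=1..n. a_star n x i) - int (coinv n x)"
    by simp
  moreover have "orbit_dim n x = enat (card cells)"
    unfolding x by (rule orbit_dim_rook_mat[OF infinite_UNIV_alg_closed])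
  ultimately show ?thesis by blast
qed

end
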